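(* Let $n\ge 2$, let $1\le k<n$, and let $d=k+2d_1$ with $d_1=(n-1)(2^k-1)$. Let $V$, the local projection $\vartheta:N_n^{d,*}\to V$ and the parity functional $\varepsilon:V\to\mathbb F_2$ be as defined in the context. Then $$\vartheta\bigl(A^\sharp_+(N_n)\cap N_n^{d,*}\bigr)=\ker(\varepsilon).$$ Equivalently, the sequence $$0\longrightarrow \vartheta\bigl(A^\sharp_+(N_n)\cap N_n^{d,*}\bigr)\longrightarrow V\xrightarrow{\ \varepsilon\ }\mathbb F_2\longrightarrow 0$$ is exact, and hence $V/\vartheta\bigl(A^\sharp_+(N_n)\cap N_n^{d,*}\bigr)\cong\mathbb F_2$. If $u\in N_n^{d,*}$ satisfies $\varepsilon(\vartheta(u))=1$, then $u\notin A^\sharp_+(N_n)$. In particular, for every subset $S\subset\mathrm{Mono}(k)$ of odd cardinality, the element $\sum_{\sigma\in S}\sigma(z_k)$ does not lie in $A^\sharp_+(N_n)$.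
   Context: Fix integers $n\ge 2$ and $1\le k<n$; put $d_1=(n-1)(2^k-1)$ and $d=k+2d_1=(n-1)(2^{k+1}-2)+k$. The module. Let $\Lambda_n=\Lambda(x_1,\dots,x_n)$ be the exterior algebra over $\mathbb F_2$ (so $x_i^2=0$), $Y_n=\mathbb F_2[y_1,\dots,y_n]$, and $N_n=\Lambda_n\otimes Y_n$, with topological degrees $|x_i|=1$, $|y_i|=2$. (This is the quotient by $\tau$ of the mod $2$ motivic cohomology of $BV_n$ over $\mathbb C$.) $N_n^{d,*}$ is the part of topological degree $d$, $\Lambda_n^a$ the part of exterior degree $a$, and $Y_n^{2b}$ the part of topological degree $2b$ (polynomial degree $b$). Thus $N_n^{d,*}=\bigoplus_{a+2b=d}\Lambda_n^a\otimes Y_n^{2b}$; let $\mathrm{pr}_k:N_n^{d,*}\to\Lambda_n^k\otimes Y_n^{2d_1}$ be the projection. The operations. $A^\sharp$ is the mod $2$ motivic Steenrod algebra over $\mathbb C$ modulo $(\tau)$. It is generated by $Q_0$ (topological degree $1$) and $\mathcal P^a$, $a\ge1$ (topological degree $2a$), acting on $N_n$ as follows: $Q_0$ is the derivation with $Q_0(x_i)=y_i$, $Q_0(y_i)=0$; and $\mathcal P^a(\lambda y)=\lambda\,\mathcal P^a(y)$ for $\lambda\in\Lambda_n$, $y\in Y_n$, $a\ge 1$, where on $Y_n$ the $\mathcal P^a$ are determined by the Cartan formula $\mathcal P^a(fg)=\sum_{i+j=a}\mathcal P^i(f)\mathcal P^j(g)$ (with $\mathcal P^0=\mathrm{id}$),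 $\mathcal P^1(y_i)=y_i^2$, and $\mathcal P^a(y_i)=0$ for $a\ge 2$. $A^\sharp_+$ is the homogeneous positive-degree part of $A^\sharp$, and $A^\sharp_+(N_n)$ is the $\mathbb F_2$-span of all $\theta(u)$ with $\theta\in A^\sharp_+$, $u\in N_n$. $P^+(Y_n)$ is the span of all values on $Y_n$ of positive-degree elements of the subalgebra generated by the $\mathcal P^a$, $a\ge 1$. The subspace $G_n$. For a monomial $y=y_1^{e_1}\cdots y_n^{e_n}$ write $2e_i=\sum_{j\ge0}\alpha_{ij}2^j$ with $\alpha_{ij}\in\{0,1\}$, and put $\omega_j(y)=\sum_{i=1}^n\alpha_{ij}$. $G_n\subset Y_n$ is the subspace spanned by $P^+(Y_n)$ and all monomials $y$ with $(\omega_1(y),\dots,\omega_k(y))<(n-1,\dots,n-1)$ in lexicographic order. Let $\pi:\Lambda_n^k\otimes Y_n^{2d_1}\to\Lambda_n^k\otimes(Y_n/G_n)^{2d_1}$ be the quotient map. The sets $M_1$, $M_0$. $\mathrm{Mono}(k)$ is the set of strictly increasing maps $\sigma:\{1,\dots,k\}\to\{1,\dots,n\}$. For $\sigma\in\mathrm{Mono}(k)$ put $$\sigma(z_k)=x_{\sigma(1)}\cdots x_{\sigma(k)}\Bigl(\prod_{j=1}^k y_{\sigma(j)}^{2^k-2^{k-j}-1}\Bigr)\Bigl(\prod_{i\notin\mathrm{im}(\sigma)}y_i^{2^k-1}\Bigr)\in\Lambda_n^k\otimes Y_n^{2d_1},$$ and $M_1=\{\sigma(z_k)\mid\sigma\in\mathrm{Mono}(k)\}$.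 $M_0$ is a set of monomials in $\Lambda_n^k\otimes Y_n^{2d_1}$, disjoint from $M_1$, such that the elements $\pi(m)$, $m\in M_0\cup M_1$, are pairwise distinct and form a basis of $\Lambda_n^k\otimes(Y_n/G_n)^{2d_1}$ (such a set was constructed by Kameko). Put $U_0=\langle\pi(m)\mid m\in M_0\rangle$ and $V=\langle\pi(m)\mid m\in M_1\rangle$, so $\Lambda_n^k\otimes(Y_n/G_n)^{2d_1}=U_0\oplus V$ and $\{\pi(\sigma(z_k))\}_{\sigma\in\mathrm{Mono}(k)}$ is a basis of $V$. The maps. $p_{M_1}:\Lambda_n^k\otimes(Y_n/G_n)^{2d_1}\to V$ is the projection with kernel $U_0$; $\vartheta=p_{M_1}\circ\pi\circ\mathrm{pr}_k:N_n^{d,*}\to V$; and $\varepsilon:V\to\mathbb F_2$ is the linear map $\varepsilon\bigl(\sum_\sigma c_\sigma\pi(\sigma(z_k))\bigr)=\sum_\sigma c_\sigma$. *)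

theory Defs
  imports
    "HOL-Library.Poly_Mapping"
    "HOL-Library.Z2"
    "HOL-Library.FuncSet"
    "HOL-Computational_Algebra.Polynomial"
    "HOL-Algebra.Coset"
    "HOL-Algebra.FiniteProduct"
    "HOL-Algebra.Generated_Groups"
begin

section \<open>The algebras \<open>Y\<^sub>n\<close> and \<open>N\<^sub>n\<close>\<close>

text \<open>
  Polynomials over the two-element field \<^typ>\<open>bit\<close> are finitely supported functions on exponent
  vectors. An element of \<open>N\<^sub>n = \<Lambda>\<^sub>n \<otimes> Y\<^sub>n\<close> is given by its coordinates in the \<open>Y\<^sub>n\<close>-basis of
  the square-free monomials \<open>x\<^sub>I = \<Prod>i\<in>I. x\<^sub>i\<close>. The types carry infinitely many variables;
  those with index in \<open>{1..n}\<close> are selected by the carriers \<open>Yn n\<close> and \<open>Nn n\<close>.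
\<close>

type_synonym ypoly = "(nat \<Rightarrow>\<^sub>0 nat) \<Rightarrow>\<^sub>0 bit"
type_synonym nelt = "nat set \<Rightarrow>\<^sub>0 ypoly"

abbreviation keys :: "('a \<Rightarrow>\<^sub>0 'b::zero) \<Rightarrow> 'a set" where "keys \<equiv> Poly_Mapping.keys"
abbreviation lookup :: "('a \<Rightarrow>\<^sub>0 'b::zero) \<Rightarrow> 'a \<Rightarrow> 'b" where "lookup \<equiv> Poly_Mapping.lookup"
abbreviation single :: "'a \<Rightarrow> 'b \<Rightarrow> ('a \<Rightarrow>\<^sub>0 'b::zero)" where "single \<equiv> Poly_Mapping.single"

definition yvar :: "nat \<Rightarrow> ypoly"
  where "yvar i = single (single i 1) 1"

definition ymon :: "(nat \<Rightarrow>\<^sub>0 nat) \<Rightarrow> ypoly"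
  where "ymon e = single e 1"

definition mdeg :: "(nat \<Rightarrow>\<^sub>0 nat) \<Rightarrow> nat"
  where "mdeg e = (\<Sum>i\<in>keys e. lookup e i)"

definition Yn :: "nat \<Rightarrow> ypoly set"
  where "Yn n = {f. \<forall>e\<in>keys f. keys e \<subseteq> {1..n}}"

text \<open>\<open>Yhom n b\<close> has polynomial degree \<open>b\<close>, that is, topological degree \<open>2 * b\<close>.\<close>

definition Yhom :: "nat \<Rightarrow> nat \<Rightarrow> ypoly set"
  where "Yhom n b = {f \<in> Yn n. \<forall>e\<in>keys f. mdeg e = b}"

definition Nn :: "nat \<Rightarrow> nelt set"
  where "Nn n = {u. \<forall>I\<in>keys u. I \<subseteq> {1..n} \<and> lookup u I \<in> Yn n}"

definition Ntop :: "nat \<Rightarrow> nat \<Rightarrow> nelt set"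
  where "Ntop n d = {u \<in> Nn n. \<forall>I\<in>keys u. \<forall>e\<in>keys (lookup u I). card I + 2 * mdeg e = d}"

text \<open>\<open>LY n a b\<close> is \<open>\<Lambda>\<^sub>n\<^sup>a \<otimes> Y\<^sub>n\<^sup>2\<^sup>b\<close>.\<close>

definition LY :: "nat \<Rightarrow> nat \<Rightarrow> nat \<Rightarrow> nelt set"
  where "LY n a b = {u \<in> Nn n. \<forall>I\<in>keys u. card I = a \<and> lookup u I \<in> Yhom n b}"

definition yscale :: "bit \<Rightarrow> ypoly \<Rightarrow> ypoly"
  where "yscale c f = single 0 c * f"

definition nscale :: "bit \<Rightarrow> nelt \<Rightarrow> nelt"
  where "nscale c u = Poly_Mapping.map (yscale c) u"

lemma lookup_nscale [simp]: "lookup (nscale c u) I = yscale c (lookup u I)"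
  by (simp add: nscale_def yscale_def Poly_Mapping.map.rep_eq when_def)

lemma ypoly_add_self: "f + f = 0" for f :: ypoly
proof (rule poly_mapping_eqI)
  fix e
  show "lookup (f + f) e = lookup 0 e"
    unfolding lookup_add by (cases "lookup f e") simp_all
qed

lemma ypoly_two [simp]: "(2 :: ypoly) = 0"
  using ypoly_add_self[of 1] by simp

lemma nelt_add_self [simp]: "u + u = 0" for u :: nelt
  by (rule poly_mapping_eqI) (simp only: lookup_add ypoly_add_self lookup_zero)

lemma yscale_bit: "yscale c f = (if c = 1 then f else 0)"
  by (cases c) (simp_all add: yscale_def)

global_interpretation Y2: vector_space yscale
  defines yspan = Y2.span
proof
  fix a b :: bit and x y :: ypoly
  show "yscale (a + b) x = yscale a x + yscale b x"
    by (cases a; cases b) (simp_all add: yscale_bit)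
qed (simp_all add: yscale_bit)

global_interpretation N2: vector_space nscale
  defines nspan = N2.span
  by standard (auto intro!: poly_mapping_eqI
      simp: lookup_add Y2.scale_right_distrib Y2.scale_left_distrib)

text \<open>The product of \<open>N\<^sub>n\<close>; it serves to state that \<open>Q0\<close> below is a derivation.\<close>

definition nmult :: "nelt \<Rightarrow> nelt \<Rightarrow> nelt"
  where "nmult u v = (\<Sum>I\<in>keys u. \<Sum>J\<in>keys v.
    if I \<inter> J = {} then single (I \<union> J) (lookup u I * lookup v J) else 0)"


section \<open>The operations\<close>

text \<open>
  The derivation with \<open>x\<^sub>i \<mapsto> y\<^sub>i\<close> and \<open>y\<^sub>i \<mapsto> 0\<close>, in coordinates
  (see \<open>Q0_derivation\<close>, \<open>Q0_x\<close> and \<open>Q0_y\<close> below).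
\<close>

definition Q0 :: "nelt \<Rightarrow> nelt"
  where "Q0 u = (\<Sum>I\<in>keys u. \<Sum>i\<in>I. single (I - {i}) (yvar i * lookup u I))"

text \<open>
  \<open>total_pow f = \<Sum>a. \<P>\<^sup>a(f) T\<^sup>a\<close> is the ring homomorphism \<open>y\<^sub>i \<mapsto> y\<^sub>i + y\<^sub>i\<^sup>2 T\<close>;
  all nonzero coefficients of \<open>f\<close> are \<open>1\<close>. The properties determining \<open>Pw\<close> are proved in
  \<open>Pw_zero\<close>, \<open>Pw_add\<close>, \<open>Pw_cartan\<close>, \<open>Pw_one_yvar\<close> and \<open>Pw_ge2_yvar\<close>.
\<close>

definition total_pow :: "ypoly \<Rightarrow> ypoly poly"
  where "total_pow f = (\<Sum>e\<in>keys f. \<Prod>i\<in>keys e. [:yvar i, (yvar i)\<^sup>2:] ^ lookup e i)"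

definition Pw :: "nat \<Rightarrow> ypoly \<Rightarrow> ypoly"
  where "Pw a f = coeff (total_pow f) a"

text \<open>The extension to \<open>N\<^sub>n\<close> that commutes with all \<open>x\<^sub>I\<close>; see \<open>PN_module\<close> below.\<close>

definition PN :: "nat \<Rightarrow> nelt \<Rightarrow> nelt"
  where "PN a u = Poly_Mapping.map (Pw a) u"

text \<open>
  \<open>graded_ops Gs r \<theta>\<close>: \<open>\<theta>\<close> is the action of an element of degree \<open>r\<close> of the graded
  \<open>\<bbbF>\<^sub>2\<close>-algebra generated by the operations in \<open>Gs\<close>, each listed with its degree.
\<close>

inductive graded_ops :: "(nat \<times> ('m \<Rightarrow> 'm)) set \<Rightarrow> nat \<Rightarrow> ('m::ab_group_add \<Rightarrow> 'm) \<Rightarrow> bool"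
  for Gs where
  unit: "graded_ops Gs 0 (\<lambda>u. u)"
| gen: "(r, \<theta>) \<in> Gs \<Longrightarrow> graded_ops Gs r \<theta>"
| zero: "graded_ops Gs r (\<lambda>u. 0)"
| add: "graded_ops Gs r \<theta> \<Longrightarrow> graded_ops Gs r \<phi> \<Longrightarrow> graded_ops Gs r (\<lambda>u. \<theta> u + \<phi> u)"
| comp: "graded_ops Gs r \<theta> \<Longrightarrow> graded_ops Gs s \<phi> \<Longrightarrow> graded_ops Gs (r + s) (\<lambda>u. \<theta> (\<phi> u))"

definition A_sharp :: "nat \<Rightarrow> (nelt \<Rightarrow> nelt) \<Rightarrow> bool"
  where "A_sharp = graded_ops (insert (1, Q0) {(2 * a, PN a) | a. a \<ge> 1})"

definition A_plus :: "nat \<Rightarrow> nelt set"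
  where "A_plus n = nspan {\<theta> u | \<theta> u. (\<exists>r>0. A_sharp r \<theta>) \<and> u \<in> Nn n}"

definition P_plus :: "nat \<Rightarrow> ypoly set"
  where "P_plus n = yspan {\<theta> f | \<theta> f.
    (\<exists>r>0. graded_ops {(2 * a, Pw a) | a. a \<ge> 1} r \<theta>) \<and> f \<in> Yn n}"


section \<open>The quotient by \<open>G\<^sub>n\<close>\<close>

definition d1 :: "nat \<Rightarrow> nat \<Rightarrow> nat"
  where "d1 n k = (n - 1) * (2 ^ k - 1)"

definition dtop :: "nat \<Rightarrow> nat \<Rightarrow> nat"
  where "dtop n k = k + 2 * d1 n k"

definition omega :: "nat \<Rightarrow> (nat \<Rightarrow>\<^sub>0 nat) \<Rightarrow> nat \<Rightarrow> nat"
  where "omega n e j = (\<Sum>i=1..n. (2 * lookup e i) div 2 ^ j mod 2)"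

text \<open>On lists of equal length, \<^const>\<open>lex\<close> is the lexicographic order.\<close>

definition Gn :: "nat \<Rightarrow> nat \<Rightarrow> ypoly set"
  where "Gn n k = yspan (P_plus n \<union>
    {ymon e | e. keys e \<subseteq> {1..n} \<and>
       (map (omega n e) [1..<k+1], replicate k (n - 1)) \<in> lex less_than})"

text \<open>
  From here on \<open>\<bbbF>\<^sub>2\<close>-vector spaces occur as groups in the sense of HOL-Algebra: over the prime
  field, subspaces, spans and linear maps are subgroups, generated subgroups and homomorphisms.
\<close>

definition additive_group :: "'a::ab_group_add set \<Rightarrow> 'a monoid"
  where "additive_group A = \<lparr>carrier = A, monoid.mult = (+), one = 0\<rparr>"

abbreviation F2 :: "bit monoid"
  where "F2 \<equiv> additive_group UNIV"

definition F2_basis :: "('a, 'b) monoid_scheme \<Rightarrow> 'a set \<Rightarrow> bool"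
  where "F2_basis H B \<longleftrightarrow> B \<subseteq> carrier H \<and> generate H B = carrier H \<and>
    (\<forall>S\<subseteq>B. finite S \<and> finprod H (\<lambda>b. b) S = \<one>\<^bsub>H\<^esub> \<longrightarrow> S = {})"

text \<open>
  \<open>\<Lambda>\<^sub>n\<^sup>k \<otimes> (Y\<^sub>n/G\<^sub>n)\<^sup>2\<^sup>d\<^sup>1\<close> is the quotient of \<open>\<Lambda>\<^sub>n\<^sup>k \<otimes> Y\<^sub>n\<^sup>2\<^sup>d\<^sup>1\<close> by
  \<open>\<Lambda>\<^sub>n\<^sup>k \<otimes> G\<^sub>n\<^sup>2\<^sup>d\<^sup>1\<close>, the space of elements with all coordinates in \<open>G\<^sub>n\<close>.
\<close>

definition LG :: "nat \<Rightarrow> nat \<Rightarrow> nelt set"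
  where "LG n k = {u \<in> LY n k (d1 n k). \<forall>I\<in>keys u. lookup u I \<in> Gn n k}"

definition Quot :: "nat \<Rightarrow> nat \<Rightarrow> nelt set monoid"
  where "Quot n k = additive_group (LY n k (d1 n k)) Mod LG n k"

definition quot_map :: "nat \<Rightarrow> nat \<Rightarrow> nelt \<Rightarrow> nelt set"
  where "quot_map n k u = LG n k #>\<^bsub>additive_group (LY n k (d1 n k))\<^esub> u"


section \<open>The local projection and the parity functional\<close>

text \<open>The index functions are extensional on \<open>{1..k}\<close>, so that each map is counted once.\<close>

definition Mono_maps :: "nat \<Rightarrow> nat \<Rightarrow> (nat \<Rightarrow> nat) set"
  where "Mono_maps n k = {\<sigma> \<in> {1..k} \<rightarrow>\<^sub>E {1..n}. strict_mono_on {1..k} \<sigma>}"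

text \<open>Here \<open>x\<^sub>\<sigma>\<^sub>(\<^sub>1\<^sub>) \<cdots> x\<^sub>\<sigma>\<^sub>(\<^sub>k\<^sub>) = x\<^sub>I\<close> with \<open>I\<close> the image of \<open>\<sigma>\<close>.\<close>

definition sigma_z :: "nat \<Rightarrow> nat \<Rightarrow> (nat \<Rightarrow> nat) \<Rightarrow> nelt"
  where "sigma_z n k \<sigma> = single (\<sigma> ` {1..k})
    ((\<Prod>j=1..k. yvar (\<sigma> j) ^ (2 ^ k - 2 ^ (k - j) - 1)) *
     (\<Prod>i\<in>{1..n} - \<sigma> ` {1..k}. yvar i ^ (2 ^ k - 1)))"

definition M1 :: "nat \<Rightarrow> nat \<Rightarrow> nelt set"
  where "M1 n k = sigma_z n k ` Mono_maps n k"

definition monomials :: "nat \<Rightarrow> nat \<Rightarrow> nat \<Rightarrow> nelt set"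
  where "monomials n a b = {single I (ymon e) | I e.
    I \<subseteq> {1..n} \<and> card I = a \<and> keys e \<subseteq> {1..n} \<and> mdeg e = b}"

definition admissible_M0 :: "nat \<Rightarrow> nat \<Rightarrow> nelt set \<Rightarrow> bool"
  where "admissible_M0 n k M0 \<longleftrightarrow>
    M0 \<subseteq> monomials n k (d1 n k) \<and> M0 \<inter> M1 n k = {} \<and>
    inj_on (quot_map n k) (M0 \<union> M1 n k) \<and>
    F2_basis (Quot n k) (quot_map n k ` (M0 \<union> M1 n k))"

definition U0 :: "nat \<Rightarrow> nat \<Rightarrow> nelt set \<Rightarrow> nelt set set"
  where "U0 n k M0 = generate (Quot n k) (quot_map n k ` M0)"

definition Vn :: "nat \<Rightarrow> nat \<Rightarrow> nelt set monoid"
  where "Vn n k = (Quot n k)\<lparr>carrier := generate (Quot n k) (quot_map n k ` M1 n k)\<rparr>"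

definition pr :: "nat \<Rightarrow> nelt \<Rightarrow> nelt"
  where "pr k u = (\<Sum>I\<in>{I \<in> keys u. card I = k}. single I (lookup u I))"

definition p_M1 :: "nat \<Rightarrow> nat \<Rightarrow> nelt set \<Rightarrow> nelt set \<Rightarrow> nelt set"
  where "p_M1 n k M0 w =
    (THE v. v \<in> carrier (Vn n k) \<and> (\<exists>u\<in>U0 n k M0. w = u \<otimes>\<^bsub>Quot n k\<^esub> v))"

definition vartheta :: "nat \<Rightarrow> nat \<Rightarrow> nelt set \<Rightarrow> nelt \<Rightarrow> nelt set"
  where "vartheta n k M0 u = p_M1 n k M0 (quot_map n k (pr k u))"

definition eps :: "nat \<Rightarrow> nat \<Rightarrow> nelt set \<Rightarrow> bit"
  where "eps n k v = (THE b. \<exists>c :: (nat \<Rightarrow> nat) \<Rightarrow> bit.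
    v = finprod (Vn n k)
          (\<lambda>\<sigma>. if c \<sigma> = 1 then quot_map n k (sigma_z n k \<sigma>) else \<one>\<^bsub>Vn n k\<^esub>) (Mono_maps n k) \<and>
    b = (\<Sum>\<sigma>\<in>Mono_maps n k. c \<sigma>))"

definition Hit :: "nat \<Rightarrow> nat \<Rightarrow> nelt set \<Rightarrow> nelt set set"
  where "Hit n k M0 = vartheta n k M0 ` (A_plus n \<inter> Ntop n (dtop n k))"


section \<open>The characterising properties of the operations\<close>

lemma keys_sum_superset:
  assumes "finite A" "keys u \<subseteq> A" "\<And>I. F I 0 = 0"
  shows "(\<Sum>I\<in>keys u. F I (lookup u I)) = (\<Sum>I\<in>A. F I (lookup u I))"
  using assms by (intro sum.mono_neutral_left) (auto simp: in_keys_iff)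

lemma keys_sum_add:
  assumes "\<And>I. F I 0 = 0" "\<And>I a b. F I (a + b) = F I a + F I b"
  shows "(\<Sum>I\<in>keys (u + v). F I (lookup (u + v) I)) =
    (\<Sum>I\<in>keys u. F I (lookup u I)) + (\<Sum>I\<in>keys v. F I (lookup v I))"
proof -
  have *: "(\<Sum>I\<in>keys w. F I (lookup w I)) = (\<Sum>I\<in>keys u \<union> keys v. F I (lookup w I))"
    if "keys w \<subseteq> keys u \<union> keys v" for w
    using that assms(1) by (intro keys_sum_superset) auto
  show ?thesis
    unfolding *[OF Poly_Mapping.keys_add] *[OF Un_upper1] *[OF Un_upper2]
    by (simp add: assms(2) sum.distrib lookup_add)
qed

lemma sum_singles: "(\<Sum>I\<in>keys u. single I (lookup u I)) = u"
  by (rule poly_mapping_eqI) (simp add: lookup_sum lookup_single when_def in_keys_iff)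

lemma ypoly_poly_two [simp]: "(2 :: ypoly poly) = 0"
  by (simp add: numeral_poly)

lemma total_pow_alt:
  "total_pow f = (\<Sum>e\<in>keys f.
     (\<lambda>e c. if c = 0 then 0 else \<Prod>i\<in>keys e. [:yvar i, (yvar i)\<^sup>2:] ^ lookup e i) e (lookup f e))"
  unfolding total_pow_def by (intro sum.cong) (auto simp: in_keys_iff)

lemma total_pow_add: "total_pow (f + g) = total_pow f + total_pow g"
  unfolding total_pow_alt
proof (rule keys_sum_add, goal_cases)
  case (2 I a b)
  then show ?case by (cases a; cases b) auto
qed auto

lemma total_pow_0 [simp]: "total_pow 0 = 0"
  by (simp add: total_pow_def)

lemma total_pow_sum: "total_pow (\<Sum>i\<in>A. f i) = (\<Sum>i\<in>A. total_pow (f i))"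
  by (induction A rule: infinite_finite_induct) (auto simp: total_pow_add)

lemma total_pow_ymon:
  assumes "finite A" "keys e \<subseteq> A"
  shows "total_pow (single e 1) = (\<Prod>i\<in>A. [:yvar i, (yvar i)\<^sup>2:] ^ lookup e i)"
  unfolding total_pow_def using assms
  by simp (intro prod.mono_neutral_left, auto simp: in_keys_iff)

lemma total_pow_mult_ymon:
  "total_pow (single e 1 * single e' 1) = total_pow (single e 1) * total_pow (single e' 1)"
proof -
  let ?A = "keys e \<union> keys e'"
  have "keys (e + e') \<subseteq> ?A" by (rule Poly_Mapping.keys_add)
  then show ?thesis
    by (simp add: mult_single total_pow_ymon[of ?A] lookup_add power_add prod.distrib)
qed

lemma ypoly_expand: "f = (\<Sum>e\<in>keys f. single e 1)" for f :: ypoly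
proof -
  have "f = (\<Sum>e\<in>keys f. single e (lookup f e))" by (simp add: sum_singles)
  also have "\<dots> = (\<Sum>e\<in>keys f. single e 1)"
    by (intro sum.cong) (auto simp: in_keys_iff)
  finally show ?thesis .
qed

lemma total_pow_mult: "total_pow (f * g) = total_pow f * total_pow g"
proof -
  have "f * g = (\<Sum>e\<in>keys f. \<Sum>e'\<in>keys g. single e 1 * single e' 1)"
    by (subst ypoly_expand[of f], subst ypoly_expand[of g]) (simp add: sum_product)
  then have "total_pow (f * g) =
      (\<Sum>e\<in>keys f. \<Sum>e'\<in>keys g. total_pow (single e 1) * total_pow (single e' 1))"
    by (simp add: total_pow_sum total_pow_mult_ymon)
  also have "\<dots> = total_pow (\<Sum>e\<in>keys f. single e 1) * total_pow (\<Sum>e\<in>keys g. single e 1)"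
    by (simp add: total_pow_sum sum_product)
  also have "\<dots> = total_pow f * total_pow g"
    by (simp flip: ypoly_expand)
  finally show ?thesis .
qed

lemma Pw_add: "Pw a (f + g) = Pw a f + Pw a g"
  by (simp add: Pw_def total_pow_add)

lemma Pw_cartan: "Pw a (f * g) = (\<Sum>i\<le>a. Pw i f * Pw (a - i) g)"
  by (simp add: Pw_def total_pow_mult coeff_mult)

lemma total_pow_yvar: "total_pow (yvar i) = [:yvar i, (yvar i)\<^sup>2:]"
  by (simp add: total_pow_def yvar_def)

lemma Pw_one_yvar: "Pw 1 (yvar i) = (yvar i)\<^sup>2"
  by (simp add: Pw_def total_pow_yvar)

lemma Pw_ge2_yvar: "a \<ge> 2 \<Longrightarrow> Pw a (yvar i) = 0"
  by (simp add: Pw_def total_pow_yvar coeff_pCons split: nat.split)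

lemma yvar_power: "yvar i ^ m = single (single i m) 1"
  by (induction m) (simp_all add: yvar_def mult_single flip: single_add)

lemma prod_yvar_power:
  assumes "finite A" "inj_on s A"
  shows "(\<Prod>i\<in>A. yvar (s i) ^ m i) = single (\<Sum>i\<in>A. single (s i) (m i)) 1"
  using assms by (induction A rule: finite_induct) (auto simp: yvar_power mult_single)

lemma Pw_zero: "Pw 0 f = f"
proof -
  have "Pw 0 (single e 1) = single e 1" for e
  proof -
    have "Pw 0 (single e 1) = (\<Prod>i\<in>keys e. yvar i ^ lookup e i)"
      by (simp add: Pw_def total_pow_def coeff_0_power flip: poly_0_coeff_0 add: poly_prod)
    then show ?thesis
      using prod_yvar_power[of "keys e" "\<lambda>i. i" "lookup e"] by (simp add: sum_singles)
  qed
  then have "Pw 0 (\<Sum>e\<in>keys f. single e 1) = (\<Sum>e\<in>keys f. single e 1)"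
    by (simp add: Pw_def total_pow_sum coeff_sum)
  then show ?thesis
    by (simp flip: ypoly_expand)
qed

lemma Pw_of_0 [simp]: "Pw a 0 = 0"
  by (simp add: Pw_def)

lemma lookup_PN: "lookup (PN a u) I = Pw a (lookup u I)"
  by (simp add: PN_def Poly_Mapping.map.rep_eq when_def)

lemma Q0_add: "Q0 (u + v) = Q0 u + Q0 v"
  unfolding Q0_def
  by (rule keys_sum_add[where F = "\<lambda>I f. \<Sum>i\<in>I. single (I - {i}) (yvar i * f)"])
    (auto simp: distrib_left single_add sum.distrib)

lemma Q0_0 [simp]: "Q0 0 = 0"
  by (simp add: Q0_def)

lemma Q0_sum: "Q0 (\<Sum>i\<in>A. f i) = (\<Sum>i\<in>A. Q0 (f i))"
  by (induction A rule: infinite_finite_induct) (auto simp: Q0_add)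

lemma Q0_single: "Q0 (single I f) = (\<Sum>i\<in>I. single (I - {i}) (yvar i * f))"
  by (cases "f = 0") (auto simp: Q0_def)

lemma Q0_x: "Q0 (single {i} 1) = single {} (yvar i)"
  by (simp add: Q0_single)

lemma Q0_y: "Q0 (single {} f) = 0"
  by (simp add: Q0_single)

lemma nmult_add_right: "nmult u (v + w) = nmult u v + nmult u w"
  unfolding nmult_def sum.distrib[symmetric]
  by (intro sum.cong refl
      keys_sum_add[where F = "\<lambda>J g. if _ \<inter> J = {} then single (_ \<union> J) (_ * g) else 0"])
    (auto simp: distrib_left single_add)

lemma nmult_add_left: "nmult (u + v) w = nmult u w + nmult v w"
  unfolding nmult_def
  by (rule keys_sum_add[where F = "\<lambda>I f. \<Sum>J\<in>keys w.
        if I \<inter> J = {} then single (I \<union> J) (f * lookup w J) else 0"])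
    (auto simp: distrib_right single_add sum.distrib[symmetric] intro!: sum.cong sum.neutral)

lemma nmult_0 [simp]: "nmult 0 u = 0" "nmult u 0 = 0"
  by (simp_all add: nmult_def)

lemma nmult_sum_left: "nmult (\<Sum>i\<in>A. f i) v = (\<Sum>i\<in>A. nmult (f i) v)"
  by (induction A rule: infinite_finite_induct) (auto simp: nmult_add_left)

lemma nmult_sum_right: "nmult u (\<Sum>i\<in>A. f i) = (\<Sum>i\<in>A. nmult u (f i))"
  by (induction A rule: infinite_finite_induct) (auto simp: nmult_add_right)

lemma nmult_single:
  "nmult (single I f) (single J g) = (if I \<inter> J = {} then single (I \<union> J) (f * g) else 0)"
  by (cases "f = 0"; cases "g = 0") (auto simp: nmult_def)

lemma nmult_x_self: "nmult (single {i} 1) (single {i} 1) = 0"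
  by (simp add: nmult_single)

lemma PN_add: "PN a (u + v) = PN a u + PN a v"
  by (rule poly_mapping_eqI) (simp add: lookup_PN lookup_add Pw_add)

lemma PN_module: "PN a (nmult (single I 1) (single {} f)) = nmult (single I 1) (single {} (Pw a f))"
  by (rule poly_mapping_eqI) (simp add: nmult_single lookup_PN lookup_single when_def)

lemma Q0_derivation_single:
  assumes "finite I" "finite J"
  shows "Q0 (nmult (single I f) (single J g)) =
    nmult (Q0 (single I f)) (single J g) + nmult (single I f) (Q0 (single J g))"
    (is "?l = ?a + ?b")
proof -
  have a: "?a = (\<Sum>i\<in>I. if (I - {i}) \<inter> J = {} then
      single ((I - {i}) \<union> J) (yvar i * (f * g)) else 0)"
    by (simp add: Q0_single nmult_sum_left nmult_single mult.assoc cong: if_cong)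
  have b: "?b = (\<Sum>i\<in>J. if I \<inter> (J - {i}) = {} then
      single (I \<union> (J - {i})) (yvar i * (f * g)) else 0)"
    by (simp add: Q0_single nmult_sum_right nmult_single mult.left_commute cong: if_cong)
  show ?thesis
  proof (cases "I \<inter> J = {}")
    case True
    have "?l = (\<Sum>i\<in>I \<union> J. single (I \<union> J - {i}) (yvar i * (f * g)))"
      using True by (simp add: nmult_single Q0_single)
    also have "\<dots> = (\<Sum>i\<in>I. single (I \<union> J - {i}) (yvar i * (f * g))) +
        (\<Sum>i\<in>J. single (I \<union> J - {i}) (yvar i * (f * g)))"
      using True assms by (simp add: sum.union_disjoint)
    also have "(\<Sum>i\<in>I. single (I \<union> J - {i}) (yvar i * (f * g))) = ?a"
    proof (unfold a, rule sum.cong)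
      fix i assume "i \<in> I"
      then have "(I - {i}) \<inter> J = {}" "I \<union> J - {i} = (I - {i}) \<union> J" using True by auto
      then show "single (I \<union> J - {i}) (yvar i * (f * g)) =
        (if (I - {i}) \<inter> J = {} then single ((I - {i}) \<union> J) (yvar i * (f * g)) else 0)" by simp
    qed simp
    also have "(\<Sum>i\<in>J. single (I \<union> J - {i}) (yvar i * (f * g))) = ?b"
    proof (unfold b, rule sum.cong)
      fix i assume "i \<in> J"
      then have "I \<inter> (J - {i}) = {}" "I \<union> J - {i} = I \<union> (J - {i})" using True by auto
      then show "single (I \<union> J - {i}) (yvar i * (f * g)) =
        (if I \<inter> (J - {i}) = {} then single (I \<union> (J - {i})) (yvar i * (f * g)) else 0)" by simp
    qed simp
    finally show ?thesis .
  next
    case False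
    then obtain m where m: "m \<in> I" "m \<in> J" by blast
    let ?c = "if I \<inter> J = {m} then single (I \<union> J) (yvar m * (f * g)) else (0::nelt)"
    have "?a = (\<Sum>i\<in>I. if i = m then ?c else 0)"
      unfolding a
    proof (rule sum.cong)
      fix i assume "i \<in> I"
      have "(I - {i}) \<inter> J = {} \<longleftrightarrow> i = m \<and> I \<inter> J = {m}" using m by auto
      moreover have "(I - {m}) \<union> J = I \<union> J" using m by auto
      ultimately show "(if (I - {i}) \<inter> J = {} then
        single ((I - {i}) \<union> J) (yvar i * (f * g)) else 0) = (if i = m then ?c else 0)" by auto
    qed simp
    then have a': "?a = ?c" using m assms by simp
    have "?b = (\<Sum>i\<in>J. if i = m then ?c else 0)"
      unfolding b
    proof (rule sum.cong)
      fix i assume "i \<in> J"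
      have "I \<inter> (J - {i}) = {} \<longleftrightarrow> i = m \<and> I \<inter> J = {m}" using m by auto
      moreover have "I \<union> (J - {m}) = I \<union> J" using m by auto
      ultimately show "(if I \<inter> (J - {i}) = {} then
        single (I \<union> (J - {i})) (yvar i * (f * g)) else 0) = (if i = m then ?c else 0)" by auto
    qed simp
    then have b': "?b = ?c" using m assms by simp
    show ?thesis unfolding a' b' using False by (simp add: nmult_single)
  qed
qed

lemma Q0_derivation:
  assumes "u \<in> Nn n" "v \<in> Nn n"
  shows "Q0 (nmult u v) = nmult (Q0 u) v + nmult u (Q0 v)"
proof -
  define U where "U = (\<lambda>I. single I (lookup u I))"
  define W where "W = (\<lambda>I. single I (lookup v I))"
  have fin: "finite I" if "I \<in> keys u \<or> I \<in> keys v" for I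
    using that assms finite_subset[of I "{1..n}"] by (auto simp: Nn_def)
  have "Q0 (nmult (\<Sum>I\<in>keys u. U I) (\<Sum>J\<in>keys v. W J)) =
    (\<Sum>J\<in>keys v. \<Sum>I\<in>keys u. Q0 (nmult (U I) (W J)))"
    by (simp add: nmult_sum_left nmult_sum_right Q0_sum)
  also have "\<dots> = (\<Sum>J\<in>keys v. \<Sum>I\<in>keys u. nmult (Q0 (U I)) (W J) + nmult (U I) (Q0 (W J)))"
    by (intro sum.cong refl) (auto simp: U_def W_def fin Q0_derivation_single)
  also have "\<dots> = nmult (Q0 (\<Sum>I\<in>keys u. U I)) (\<Sum>J\<in>keys v. W J) +
      nmult (\<Sum>I\<in>keys u. U I) (Q0 (\<Sum>J\<in>keys v. W J))"
    by (simp add: nmult_sum_left nmult_sum_right Q0_sum sum.distrib)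
  finally show ?thesis by (simp add: U_def W_def sum_singles)
qed

end

theory Submission
  imports Defs "HOL-Combinatorics.Transposition"
begin

text \<open>
  The classes in degree \<open>d1\<close> modulo \<open>G\<^sub>n\<close> come from the monomials in which each of the \<open>k\<close> binary
  positions is missing from exactly one exponent. For a set \<open>I\<close> of size \<open>k\<close> let \<open>\<lambda>\<^sub>I\<close> count modulo \<open>2\<close>
  those monomials of a polynomial whose missing positions are distributed bijectively over \<open>I\<close>.
  Parity of binomial coefficients shows that \<open>\<lambda>\<^sub>I\<close> vanishes on \<open>G\<^sub>n\<close>, and \<open>\<P>\<close> applied to a suitable
  monomial shows that exchanging the missing positions of two variables does not change the class.
  So no monomial of \<open>M0\<close> over \<open>x\<^sub>I\<close> is seen by \<open>\<lambda>\<^sub>I\<close>, and \<open>\<lambda>\<^sub>I\<close> is the coefficient of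
  \<open>\<pi>(\<sigma>(z\<^sub>k))\<close>, \<open>im \<sigma> = I\<close>, whatever \<open>M0\<close> is. In \<open>Q\<^sub>0(x\<^sub>J y\<^sup>e) = \<Sum>i\<in>J. x\<^bsub>J - {i}\<^esub> y\<^sub>i y\<^sup>e\<close> either none or
  exactly two summands are seen; hence \<open>\<epsilon> \<circ> \<vartheta>\<close> kills all hits, and every sum of two basis
  vectors of \<open>V\<close> with neighbouring index sets is reached. These sums span the kernel of \<open>\<epsilon>\<close>.
\<close>

section \<open>Parity of binomial coefficients\<close>

text \<open>Everything reduces to binary digits of exponents. By Lucas' congruence,
  \<open>Pw a\<close> sends y^g to the sum of all y^(g+h) where the h i add up to a and the digits
  of each h i lie among those of g i. Adding 2^t to an all-ones exponent that lacks position t+1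
  produces a carry and moves the gap from t+1 to t; this carry is the source of the relation that
  exchanges two neighbouring missing positions, and hence of all sorting. \<open>Q0\<close> adds 1
  to one exponent, which fills a gap at position 0 and nothing else; therefore its visible summands
  come from the two variables that lack position 0. The set \<open>M0\<close> is arbitrary, so the
  projection onto V cannot be computed from an explicit basis. It is instead read off from
  functionals that live on N_n itself. Their sum \<open>par\<close> is defined in every degree, so
  its vanishing on hits is checked on generators of \<open>A_plus n\<close>, and hits are never
  split into homogeneous parts.\<close>

lemma choose_double_parity:
  "even (2 * g choose Suc (2 * h)) \<and> (odd (2 * g choose (2 * h)) \<longleftrightarrow> odd (g choose h))"
proof (induction g arbitrary: h)
  case 0
  show ?case by (cases h) auto
next
  case (Suc g)
  show ?case
  proof (cases h)
    case 0
    then show ?thesis by simp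
  next
    case (Suc h')
    \<comment> \<open>With this r one has \<open>2 * h = Suc r\<close>, and Pascal's rule used twice
      expresses row 2g+2 by row 2g with the middle entry doubled.\<close>
    define r where "r = Suc (2 * h')"
    have "2 * h = Suc r" "2 * h' + 2 = Suc r" using Suc by (auto simp: r_def)
    moreover have "odd (2 * g choose (2 * h')) \<longleftrightarrow> odd (g choose h')"
      "odd (2 * g choose Suc r) \<longleftrightarrow> odd (g choose Suc h')"
      "even (2 * g choose r)" "even (2 * g choose Suc (Suc r))"
      using Suc.IH[of h'] Suc.IH[of "Suc h'"] by (simp_all add: r_def)
    moreover have "2 * Suc g choose Suc r = (2 * g choose (2 * h')) + 2 * (2 * g choose r) + (2 * g choose Suc r)"
      by (simp add: r_def)
    moreover have "2 * Suc g choose Suc (Suc r) = (2 * g choose r) + 2 * (2 * g choose Suc r) + (2 * g choose Suc (Suc r))"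
      by simp
    ultimately show ?thesis by (simp add: Suc)
  qed
qed

lemma odd_choose_double: "odd (g choose (2 * h)) \<longleftrightarrow> odd (g div 2 choose h)"
proof -
  obtain a where "g = 2 * a \<or> g = Suc (2 * a)" by (metis evenE oddE Suc_eq_plus1)
  moreover have "odd (Suc (2 * a) choose (2 * h)) \<longleftrightarrow> odd (a choose h)"
    using choose_double_parity[of a "h - 1"] choose_double_parity[of a h] by (cases h) auto
  ultimately show ?thesis using choose_double_parity[of a h] by auto
qed

text \<open>One digit of Lucas' theorem modulo 2: an odd binomial coefficient forces the digits of h
  to lie among those of g.\<close>

lemma odd_choose_halves:
  assumes "odd (g choose h)"
  shows "odd (g div 2 choose (h div 2))" "odd h \<Longrightarrow> odd g"
proof -
  obtain a where a: "g = 2 * a \<or> g = Suc (2 * a)"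
    by (metis evenE oddE Suc_eq_plus1)
  obtain b where b: "h = 2 * b \<or> h = Suc (2 * b)"
    by (metis evenE oddE Suc_eq_plus1)
  have "even (2 * a choose Suc (2 * b'))" "odd (2 * a choose (2 * b')) \<longleftrightarrow> odd (a choose b')" for b'
    using choose_double_parity by auto
  note D = this
  have "odd (Suc (2 * a) choose (2 * b)) \<longleftrightarrow> odd (a choose b)"
    using odd_choose_double[of "Suc (2 * a)" b] by simp
  moreover have "odd (Suc (2 * a) choose Suc (2 * b)) \<longleftrightarrow> odd (a choose b)"
    using D(1)[of b] D(2)[of b] by simp
  ultimately show "odd (g div 2 choose (h div 2))" "odd h \<Longrightarrow> odd g"
    using a b D[of b] assms by auto
qed

lemma odd_choose_two_power: "odd (g choose 2 ^ t) \<longleftrightarrow> odd (g div 2 ^ t)"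
proof (induction t arbitrary: g)
  case (Suc t)
  then show ?case using odd_choose_double[of g "2 ^ t"] by (simp only: power_Suc div_mult2_eq)
qed simp

lemma odd_choose_div_power:
  "odd (g choose h) \<Longrightarrow> odd (g div 2 ^ p choose (h div 2 ^ p))"
proof (induction p)
  case (Suc p)
  then show ?case
    using odd_choose_halves(1)[of "g div 2 ^ p" "h div 2 ^ p"]
    by (simp add: div_mult2_eq[symmetric] mult.commute)
qed simp

section \<open>Exponents with all binary digits one, or all but one\<close>

definition ones :: "nat \<Rightarrow> nat"
  where "ones k = 2 ^ k - 1"

definition ones_but :: "nat \<Rightarrow> nat \<Rightarrow> nat"
  where "ones_but k m = 2 ^ k - 1 - 2 ^ m"

lemma two_power_less: "m < k \<Longrightarrow> (2::nat) ^ m + 1 \<le> 2 ^ k"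
  unfolding Suc_eq_plus1[symmetric] Suc_le_eq by simp

text \<open>Since the digits of h lie among those of g, an odd sum leaves the last digit 1 to g and
  0 to h; no carry arises, and the halves are in the same situation.\<close>

lemma odd_choose_ones:
  assumes "odd (g choose h)" "g + h = ones k"
  shows "h = 0"
  using assms unfolding ones_def
proof (induction k arbitrary: g h)
  case (Suc k)
  have "odd (g + h)" using Suc.prems(2) by simp
  then have "even h" "odd g" using odd_choose_halves(2)[OF Suc.prems(1)] by auto
  then obtain a b where ab: "g = 2 * a + 1" "h = 2 * b" by (metis evenE oddE)
  then have "a + b = 2 ^ k - 1" using Suc.prems(2) by simp
  then have "b = 0"
    using Suc.IH[of a b] odd_choose_halves(1)[OF Suc.prems(1)] ab by simp
  then show ?case using ab by simp
qed auto

text \<open>Below position m the digits behave as in \<open>odd_choose_ones\<close>. At m the digits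
  of g and h agree: two zeros leave an all-ones sum, so m is the gap of g; two ones carry and push
  the gap one position up. This is why m' need not equal m.\<close>

lemma odd_choose_ones_but:
  assumes "odd (g choose h)" "g + h = ones_but k m" "m < k"
  shows "\<exists>m'<k. g = ones_but k m'"
  using assms unfolding ones_but_def
proof (induction k arbitrary: g h m)
  case (Suc k)
  obtain a where a: "g = 2 * a \<or> g = Suc (2 * a)" by (metis evenE oddE Suc_eq_plus1)
  obtain b where b: "h = 2 * b \<or> h = Suc (2 * b)" by (metis evenE oddE Suc_eq_plus1)
  have ab: "odd (a choose b)" and hg: "odd h \<Longrightarrow> odd g"
    using odd_choose_halves[OF Suc.prems(1)] a b by auto
  have pos: "(2::nat) ^ k \<ge> 1" by simp
  show ?case
  proof (cases m)
    case 0
    then have sum: "g + h = 2 * (2 ^ k - 1)" using Suc.prems(2) by simp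
    then have "even (g + h)" by simp
    then consider "g = 2 * a" "h = 2 * b" | "g = Suc (2 * a)" "h = Suc (2 * b)"
      using a b by auto
    then show ?thesis
    proof cases
      case 1
      then have "a + b = 2 ^ k - 1" using sum by simp
      then have "b = 0" using odd_choose_ones[OF ab] by (simp add: ones_def)
      then have "g = 2 ^ Suc k - 1 - 2 ^ 0" using sum 1 by simp
      then show ?thesis by blast
    next
      case 2
      \<comment> \<open>The carry leaves a sum of halves with its gap at position 0 again; the
        second fact yields \<open>0 < k\<close>, so that such a position exists.\<close>
      then have ab2: "a + b = 2 ^ k - 1 - 2 ^ 0" "2 ^ k - 1 \<noteq> (0::nat)" using sum by simp_all
      then have "0 < k" by (cases k) auto
      from Suc.IH[OF ab ab2(1) this] obtain m' where m': "m' < k" "a = 2 ^ k - 1 - 2 ^ m'" by blast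
      have "g = 2 ^ Suc k - 1 - 2 ^ Suc m'"
        using 2 m'(2) two_power_less[OF m'(1)] by simp
      then show ?thesis using m'(1) Suc_less_eq by blast
    qed
  next
    case (Suc m0)
    then have m0: "m0 < k" using Suc.prems by simp
    then have sum: "g + h = Suc (2 * (2 ^ k - 1 - 2 ^ m0))"
      using Suc.prems(2) Suc two_power_less[OF m0] by simp
    then have "odd (g + h)" by simp
    then have gh: "g = Suc (2 * a)" "h = 2 * b" using a b hg by auto
    then have "a + b = 2 ^ k - 1 - 2 ^ m0" using sum by simp
    from Suc.IH[OF ab this m0] obtain m' where m': "m' < k" "a = 2 ^ k - 1 - 2 ^ m'" by blast
    have "g = 2 ^ Suc k - 1 - 2 ^ Suc m'"
      using gh m'(2) two_power_less[OF m'(1)] by simp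
    then show ?thesis using m'(1) Suc_less_eq by blast
  qed
qed simp

lemma odd_ones_div: "odd (ones k div 2 ^ j) \<longleftrightarrow> j < k"
  unfolding ones_def
proof (induction k arbitrary: j)
  case (Suc k)
  have "(2 ^ Suc k - 1 :: nat) = Suc (2 * (2 ^ k - 1))" by (cases "2 ^ k :: nat") auto
  then show ?case using Suc by (cases j) (simp_all add: div_mult2_eq)
qed auto

lemma odd_ones_but_div:
  "m < k \<Longrightarrow> odd (ones_but k m div 2 ^ j) \<longleftrightarrow> j < k \<and> j \<noteq> m"
  unfolding ones_but_def
proof (induction k arbitrary: j m)
  case (Suc k)
  show ?case
  proof (cases m)
    case 0
    then have "(2 ^ Suc k - 1 - 2 ^ m :: nat) = 2 * (2 ^ k - 1)" by simp
    then show ?thesis using 0 odd_ones_div[of k, unfolded ones_def]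
      by (cases j) (simp_all add: div_mult2_eq flip: One_nat_def)
  next
    case (Suc m')
    then have "m' < k" using Suc.prems by simp
    moreover from this have "(2 ^ Suc k - 1 - 2 ^ m :: nat) = Suc (2 * (2 ^ k - 1 - 2 ^ m'))"
      using Suc two_power_less[of m' k] by simp
    ultimately show ?thesis using Suc.IH[of m'] Suc by (cases j) (simp_all add: div_mult2_eq)
  qed
qed simp

lemma inj_on_ones_but: "inj_on (ones_but k) {..<k}"
proof (rule inj_onI)
  fix m m' assume *: "m \<in> {..<k}" "m' \<in> {..<k}" "ones_but k m = ones_but k m'"
  then have "(2::nat) ^ m + 1 \<le> 2 ^ k" "(2::nat) ^ m' + 1 \<le> 2 ^ k"
    by (simp_all only: lessThan_iff two_power_less)
  then have "(2 :: nat) ^ m = 2 ^ m'" using *(3) unfolding ones_but_def by linarith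
  then show "m = m'" by simp
qed

section \<open>Operations on monomials\<close>

definition expo :: "nat set \<Rightarrow> (nat \<Rightarrow> nat) \<Rightarrow> (nat \<Rightarrow>\<^sub>0 nat)"
  where "expo A x = (\<Sum>i\<in>A. single i (x i))"

lemma lookup_expo: "finite A \<Longrightarrow> lookup (expo A x) i = (if i \<in> A then x i else 0)"
  by (simp add: expo_def lookup_sum lookup_single when_def)

lemma keys_expo: "finite A \<Longrightarrow> keys (expo A x) \<subseteq> A"
  by (auto simp: in_keys_iff lookup_expo split: if_splits)

lemma mdeg_superset:
  assumes "finite A" "keys e \<subseteq> A"
  shows "mdeg e = (\<Sum>i\<in>A. lookup e i)"
  unfolding mdeg_def using assms by (intro sum.mono_neutral_left) (auto simp: in_keys_iff)

lemma mdeg_expo: "finite A \<Longrightarrow> mdeg (expo A x) = (\<Sum>i\<in>A. x i)"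
  by (subst mdeg_superset[of A]) (auto simp: lookup_expo keys_expo dest: keys_expo[THEN subsetD])

lemma prod_yvar_expo: "finite A \<Longrightarrow> (\<Prod>i\<in>A. yvar i ^ x i) = ymon (expo A x)"
  using prod_yvar_power[of A "\<lambda>i. i" x] by (simp add: ymon_def expo_def)

lemma ypoly_of_nat: "(of_nat c :: ypoly) = (if odd c then 1 else 0)"
  by (induction c) (auto simp: ypoly_add_self)

lemma total_yvar_power:
  "[:yvar i, (yvar i)\<^sup>2:] ^ g =
    (\<Sum>h\<le>g. monom (of_nat (g choose h) * yvar i ^ (g + h)) h)"
proof -
  have "[:yvar i, (yvar i)\<^sup>2:] = monom ((yvar i)\<^sup>2) 1 + monom (yvar i) 0"
    by (simp add: monom_Suc monom_0)
  then have "[:yvar i, (yvar i)\<^sup>2:] ^ g =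
    (\<Sum>h\<le>g. of_nat (g choose h) * monom ((yvar i)\<^sup>2) 1 ^ h * monom (yvar i) 0 ^ (g - h))"
    by (simp add: binomial_ring)
  also have "\<dots> = (\<Sum>h\<le>g. monom (of_nat (g choose h) * yvar i ^ (g + h)) h)"
  proof (rule sum.cong)
    fix h assume "h \<in> {..g}"
    then have *: "2 * h + (g - h) = g + h" by simp
    have "monom ((yvar i)\<^sup>2) 1 ^ h * monom (yvar i) 0 ^ (g - h) = monom (yvar i ^ (g + h)) h"
      by (simp add: monom_power mult_monom flip: power_mult power_add *)
    then show "of_nat (g choose h) * monom ((yvar i)\<^sup>2) 1 ^ h * monom (yvar i) 0 ^ (g - h) =
        monom (of_nat (g choose h) * yvar i ^ (g + h)) h"
      by (simp add: mult.assoc of_nat_poly smult_monom)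
  qed simp
  finally show ?thesis .
qed

lemma prod_monom: "(\<Prod>i\<in>A. monom (c i) (d i)) = monom (\<Prod>i\<in>A. c i) (\<Sum>i\<in>A. d i)"
  by (induction A rule: infinite_finite_induct) (simp_all add: mult_monom)

text \<open>Index set of the surviving terms of \<open>Pw a\<close> on a monomial: h i counts the
  factors y_i for which the square is chosen. The functions are extensional so that each choice
  occurs once.\<close>

definition pow_shifts :: "nat set \<Rightarrow> (nat \<Rightarrow>\<^sub>0 nat) \<Rightarrow> nat \<Rightarrow> (nat \<Rightarrow> nat) set"
  where "pow_shifts A g a = {h \<in> PiE A (\<lambda>i. {..lookup g i}).
    sum h A = a \<and> (\<forall>i\<in>A. odd (lookup g i choose h i))}"

lemma finite_pow_shifts: "finite A \<Longrightarrow> finite (pow_shifts A g a)"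
  unfolding pow_shifts_def by (rule finite_subset[OF _ finite_PiE[of A "\<lambda>i. {..lookup g i}"]]) auto

lemma Pw_ymon:
  assumes "finite A" "keys g \<subseteq> A"
  shows "Pw a (ymon g) = (\<Sum>h\<in>pow_shifts A g a. ymon (expo A (\<lambda>i. lookup g i + h i)))"
proof -
  let ?H = "PiE A (\<lambda>i. {..lookup g i})"
  let ?c = "\<lambda>h i. of_nat (lookup g i choose h i) * yvar i ^ (lookup g i + h i) :: ypoly"
  have fin: "finite ?H" using assms by (intro finite_PiE) auto
  have "total_pow (ymon g) = (\<Prod>i\<in>A. \<Sum>h\<le>lookup g i.
      monom (of_nat (lookup g i choose h) * yvar i ^ (lookup g i + h)) h)"
    unfolding ymon_def total_pow_ymon[OF assms] total_yvar_power ..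
  also have "\<dots> = (\<Sum>h\<in>?H. monom (\<Prod>i\<in>A. ?c h i) (sum h A))"
    using assms by (simp add: prod_sum_PiE prod_monom)
  finally have "Pw a (ymon g) = (\<Sum>h\<in>?H. if sum h A = a then (\<Prod>i\<in>A. ?c h i) else 0)"
    by (simp add: Pw_def coeff_sum)
  also have "\<dots> = (\<Sum>h\<in>pow_shifts A g a. ymon (expo A (\<lambda>i. lookup g i + h i)))"
  proof (rule sum.mono_neutral_cong_right[OF fin])
    show "pow_shifts A g a \<subseteq> ?H" by (auto simp: pow_shifts_def)
  next
    show "\<forall>h\<in>?H - pow_shifts A g a. (if sum h A = a then (\<Prod>i\<in>A. ?c h i) else 0) = 0"
    proof
      fix h assume h: "h \<in> ?H - pow_shifts A g a"
      show "(if sum h A = a then (\<Prod>i\<in>A. ?c h i) else 0) = 0"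
      proof (cases "sum h A = a")
        case True
        then obtain i where "i \<in> A" "even (lookup g i choose h i)"
          using h by (auto simp: pow_shifts_def)
        then have "(\<Prod>i\<in>A. ?c h i) = 0"
          using assms(1) by (intro prod_zero bexI[of _ i]) (auto simp: ypoly_of_nat)
        then show ?thesis by simp
      qed simp
    qed
  next
    fix h assume h: "h \<in> pow_shifts A g a"
    have "(\<Prod>i\<in>A. ?c h i) = (\<Prod>i\<in>A. yvar i ^ (lookup g i + h i))"
      using h by (intro prod.cong) (auto simp: pow_shifts_def ypoly_of_nat)
    then show "(if sum h A = a then (\<Prod>i\<in>A. ?c h i) else 0) =
        ymon (expo A (\<lambda>i. lookup g i + h i))"
      using h assms(1) by (simp add: pow_shifts_def prod_yvar_expo)
  qed
  finally show ?thesis .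
qed

section \<open>The functionals detecting the basis of \<open>V\<close>\<close>

lemma even_card_involution:
  assumes "finite S" "\<And>x. x \<in> S \<Longrightarrow> f x \<in> S \<and> f (f x) = x \<and> f x \<noteq> x"
  shows "even (card S)"
  using assms
proof (induction "card S" arbitrary: S rule: less_induct)
  case less
  show ?case
  proof (cases "S = {}")
    case False
    then obtain x where x: "x \<in> S" by blast
    let ?T = "S - {x, f x}"
    have sub: "{x, f x} \<subseteq> S" "card {x, f x} = 2" using less.prems(2)[OF x] x by auto
    then have card: "card S = card ?T + 2"
      using less.prems(1) by (metis card_Diff_subset card_mono finite.simps le_add_diff_inverse2)
    have "even (card ?T)"
    proof (rule less.hyps)
      fix y assume "y \<in> ?T"
      then show "f y \<in> ?T \<and> f (f y) = y \<and> f y \<noteq> y"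
        using less.prems(2)[of y] less.prems(2)[OF x] by auto
    qed (use card less.prems in auto)
    then show ?thesis using card by simp
  qed simp
qed

lemma bit_of_nat: "(of_nat c :: bit) = (if odd c then 1 else 0)"
  by (induction c) auto

text \<open>Variable \<open>i \<in> I\<close> lacks the binary position \<open>m i\<close>; positions are counted from \<open>0\<close>.\<close>

definition defexp :: "nat \<Rightarrow> nat \<Rightarrow> nat set \<Rightarrow> (nat \<Rightarrow> nat) \<Rightarrow> (nat \<Rightarrow>\<^sub>0 nat)"
  where "defexp n k I m = expo {1..n} (\<lambda>i. if i \<in> I then ones_but k (m i) else ones k)"

definition deficient :: "nat \<Rightarrow> nat \<Rightarrow> nat set \<Rightarrow> (nat \<Rightarrow>\<^sub>0 nat) \<Rightarrow> bool"
  where "deficient n k I e \<longleftrightarrow> (\<exists>m. bij_betw m I {..<k} \<and> e = defexp n k I m)"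

definition lam :: "nat \<Rightarrow> nat \<Rightarrow> nat set \<Rightarrow> ypoly \<Rightarrow> bit"
  where "lam n k I f = (\<Sum>e\<in>keys f. if deficient n k I e then lookup f e else 0)"

lemma lookup_defexp:
  "lookup (defexp n k I m) i =
    (if i \<in> {1..n} then if i \<in> I then ones_but k (m i) else ones k else 0)"
  by (simp add: defexp_def lookup_expo)

lemma keys_defexp: "keys (defexp n k I m) \<subseteq> {1..n}"
  by (simp add: defexp_def keys_expo)

lemma lam_0 [simp]: "lam n k I 0 = 0"
  by (simp add: lam_def)

lemma lam_add: "lam n k I (f + g) = lam n k I f + lam n k I g"
  unfolding lam_def
  by (rule keys_sum_add[where F = "\<lambda>e c. if deficient n k I e then c else 0"]) auto

lemma lam_sum: "lam n k I (\<Sum>x\<in>A. f x) = (\<Sum>x\<in>A. lam n k I (f x))"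
  by (induction A rule: infinite_finite_induct) (simp_all add: lam_add)

lemma lam_ymon: "lam n k I (ymon e) = (if deficient n k I e then 1 else 0)"
  by (simp add: lam_def ymon_def)

text \<open>
  \<open>(g choose h)\<close> is odd with \<open>g + h = ones_but k m\<close> only if \<open>g\<close> is of the form \<open>ones_but k m'\<close> as well.
  If two of the exponents \<open>g i\<close> with \<open>i \<in> I\<close> agree, swapping them is a fixed-point free involution of
  the relevant \<open>h\<close>; otherwise the \<open>g i\<close> exhaust these values, which leaves no room for \<open>h\<close>.
\<close>

lemma lam_Pw_ymon:
  assumes I: "I \<subseteq> {1..n}" and a: "a \<ge> 1" and g: "keys g \<subseteq> {1..n}"
  shows "lam n k I (Pw a (ymon g)) = 0"
proof -
  let ?e = "\<lambda>h. expo {1..n} (\<lambda>i. lookup g i + h i)"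
  define H where "H = {h \<in> pow_shifts {1..n} g a. deficient n k I (?e h)}"
  have fin: "finite H" "finite I"
    using finite_subset[OF I] by (auto simp: H_def finite_pow_shifts)
  have "lam n k I (Pw a (ymon g)) =
      (\<Sum>h\<in>pow_shifts {1..n} g a. if deficient n k I (?e h) then 1 else 0)"
    by (simp only: Pw_ymon[OF finite_atLeastAtMost g] lam_sum lam_ymon)
  also have "\<dots> = of_nat (card H)"
    by (simp add: H_def finite_pow_shifts sum.If_cases Int_def)
  finally have lam: "lam n k I (Pw a (ymon g)) = of_nat (card H)" .
  have shift: "\<exists>m. bij_betw m I {..<k} \<and> (\<forall>i\<in>I. lookup g i + h i = ones_but k (m i)) \<and>
      (\<forall>i\<in>{1..n} - I. lookup g i + h i = ones k)" if "h \<in> H" for h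
  proof -
    from that obtain m where m: "bij_betw m I {..<k}" "?e h = defexp n k I m"
      by (auto simp: H_def deficient_def)
    have "lookup g i + h i = (if i \<in> I then ones_but k (m i) else ones k)"
      if "i \<in> {1..n}" for i
      using arg_cong[OF m(2), of "\<lambda>e. lookup e i"] that by (simp add: lookup_expo lookup_defexp)
    then show ?thesis using m(1) subsetD[OF I]
      by (intro exI[of _ m]) (simp del: atLeastAtMost_iff One_nat_def)
  qed
  have odd: "odd (lookup g i choose h i)" if "h \<in> H" "i \<in> {1..n}" for h i
    using that by (auto simp: H_def pow_shifts_def)
  let ?M = "ones_but k ` {..<k}"
  have "even (card H)"
  proof (cases "inj_on (lookup g) I")
    case True
    have False if h: "h \<in> H" for h
    proof -
      obtain m where m: "bij_betw m I {..<k}" "\<forall>i\<in>I. lookup g i + h i = ones_but k (m i)"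
        "\<forall>i\<in>{1..n} - I. lookup g i + h i = ones k" using shift[OF h] by blast
      have card: "card I = k" using bij_betw_same_card[OF m(1)] by simp
      have "lookup g ` I \<subseteq> ?M"
      proof
        fix x assume "x \<in> lookup g ` I"
        then obtain i where i: "i \<in> I" "x = lookup g i" by blast
        then have "m i < k" using m(1) by (auto simp: bij_betw_def)
        then show "x \<in> ?M"
          using odd_choose_ones_but[OF odd[OF h, of i], of k "m i"] m(2) i subsetD[OF I, of i]
          by (auto simp del: atLeastAtMost_iff)
      qed
      moreover have "card (lookup g ` I) = card ?M"
        using True card by (simp add: card_image inj_on_ones_but)
      ultimately have img: "lookup g ` I = ?M" by (intro card_subset_eq) auto
      \<comment> \<open>On I both g and g + h run through all values of \<open>ones_but k\<close>,
        so their sums agree and h vanishes there.\<close>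
      have "(\<Sum>i\<in>I. lookup g i) = \<Sum>?M"
        unfolding img[symmetric] by (simp add: sum.reindex[OF True])
      also have "\<dots> = (\<Sum>j\<in>{..<k}. ones_but k j)"
        by (simp add: sum.reindex[OF inj_on_ones_but])
      also have "\<dots> = (\<Sum>i\<in>I. ones_but k (m i))"
        by (rule sum.reindex_bij_betw[OF m(1), symmetric])
      also have "\<dots> = (\<Sum>i\<in>I. lookup g i) + (\<Sum>i\<in>I. h i)"
        using m(2) by (simp flip: sum.distrib)
      finally have "(\<Sum>i\<in>I. h i) = 0" by simp
      moreover have "h i = 0" if "i \<in> {1..n} - I" for i
        using odd_choose_ones[OF odd[OF h, of i]] m(3) that by auto
      then have "(\<Sum>i\<in>{1..n}. h i) = (\<Sum>i\<in>I. h i)"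
        using I by (intro sum.mono_neutral_right) auto
      ultimately show False using h a by (simp add: H_def pow_shifts_def)
    qed
    then have "H = {}" by blast
    then show ?thesis by simp
  next
    case False
    then obtain i1 i2 where i12: "i1 \<in> I" "i2 \<in> I" "i1 \<noteq> i2" "lookup g i1 = lookup g i2"
      by (auto simp: inj_on_def)
    define \<tau> where "\<tau> = transpose i1 i2"
    have g\<tau>: "lookup g (\<tau> i) = lookup g i" for i
      using i12 by (simp add: \<tau>_def transpose_def)
    have \<tau>n: "\<tau> i \<in> {1..n} \<longleftrightarrow> i \<in> {1..n}" and \<tau>I: "\<tau> i \<in> I \<longleftrightarrow> i \<in> I" for i
      using i12 I by (auto simp: \<tau>_def transpose_def)
    have \<tau>\<tau>: "\<tau> (\<tau> i) = i" for i by (simp add: \<tau>_def)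
    have bij: "bij_betw \<tau> {1..n} {1..n}" "bij_betw \<tau> I I"
      by (rule bij_betw_byWitness[where f' = \<tau>]; use \<tau>n \<tau>I \<tau>\<tau> in auto)+
    show ?thesis
    proof (rule even_card_involution[OF fin(1), where f = "\<lambda>h. h \<circ> \<tau>"])
      fix h assume h: "h \<in> H"
      then have P: "h \<in> PiE {1..n} (\<lambda>i. {..lookup g i})" "sum h {1..n} = a"
        by (auto simp: H_def pow_shifts_def)
      obtain m where m: "bij_betw m I {..<k}" "\<forall>i\<in>I. lookup g i + h i = ones_but k (m i)"
        "\<forall>i\<in>{1..n} - I. lookup g i + h i = ones k" using shift[OF h] by blast
      have "sum (h \<circ> \<tau>) {1..n} = a"
        using sum.reindex_bij_betw[OF bij(1), of h] P(2) by simp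
      moreover have "h \<circ> \<tau> \<in> PiE {1..n} (\<lambda>i. {..lookup g i})"
      proof (rule PiE_I)
        fix i assume "i \<in> {1..n}"
        then show "(h \<circ> \<tau>) i \<in> {..lookup g i}" using PiE_mem[OF P(1), of "\<tau> i"] \<tau>n g\<tau> by simp
      next
        \<comment> \<open>\<tau> also preserves the complement of {1..n}, so the default value of an
          extensional function survives.\<close>
        fix i assume "i \<notin> {1..n}"
        then have "\<tau> i \<notin> {1..n}" using \<tau>n by blast
        then show "(h \<circ> \<tau>) i = undefined" using PiE_arb[OF P(1)] by (simp only: comp_apply)
      qed
      moreover have "\<forall>i\<in>{1..n}. odd (lookup g i choose (h \<circ> \<tau>) i)"
      proof
        fix i assume "i \<in> {1..n}"
        then have "\<tau> i \<in> {1..n}" using \<tau>n by blast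
        from odd[OF h this] show "odd (lookup g i choose (h \<circ> \<tau>) i)" unfolding g\<tau> by simp
      qed
      moreover have "deficient n k I (?e (h \<circ> \<tau>))"
        unfolding deficient_def
      proof (intro exI conjI)
        show "bij_betw (m \<circ> \<tau>) I {..<k}" using bij_betw_trans[OF bij(2) m(1)] .
        show "?e (h \<circ> \<tau>) = defexp n k I (m \<circ> \<tau>)"
        proof (rule poly_mapping_eqI)
          fix i
          have "lookup g i + h (\<tau> i) = (if i \<in> I then ones_but k (m (\<tau> i)) else ones k)"
            if "i \<in> {1..n}"
          proof (cases "i \<in> I")
            case True
            then have "\<tau> i \<in> I" using \<tau>I by blast
            then show ?thesis using True bspec[OF m(2)] g\<tau>[of i] by metis
          next
            case False
            then have "\<tau> i \<in> {1..n} - I" using \<tau>I \<tau>n that by blast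
            then show ?thesis using False bspec[OF m(3)] g\<tau>[of i] by metis
          qed
          then show "lookup (?e (h \<circ> \<tau>)) i = lookup (defexp n k I (m \<circ> \<tau>)) i"
            by (simp add: lookup_expo lookup_defexp)
        qed
      qed
      ultimately have "h \<circ> \<tau> \<in> H" by (simp add: H_def pow_shifts_def)
      \<comment> \<open>Equal shifts at \<open>i1\<close> and \<open>i2\<close> would give equal
        exponents g + h there, against the injectivity of m on I.\<close>
      moreover have "h \<circ> \<tau> \<noteq> h"
      proof
        assume "h \<circ> \<tau> = h"
        then have "h i1 = h i2" by (metis \<tau>_def comp_apply transpose_apply_first)
        then have "ones_but k (m i1) = ones_but k (m i2)" using m(2) i12 by metis
        moreover have "m i1 \<in> {..<k}" "m i2 \<in> {..<k}" using bij_betwE[OF m(1)] i12 by blast+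
        ultimately have "m i1 = m i2" by (rule inj_onD[OF inj_on_ones_but])
        then show False using inj_onD[OF bij_betw_imp_inj_on[OF m(1)]] i12 by blast
      qed
      moreover have "(h \<circ> \<tau>) \<circ> \<tau> = h" by (simp add: fun_eq_iff \<tau>\<tau>)
      ultimately show "h \<circ> \<tau> \<in> H \<and> (h \<circ> \<tau>) \<circ> \<tau> = h \<and> h \<circ> \<tau> \<noteq> h" by blast
    qed
  qed
  then show ?thesis unfolding lam bit_of_nat by simp
qed

section \<open>Vanishing on the image of the positive-degree power operations\<close>

lemma Pw_sum: "Pw a (\<Sum>x\<in>A. f x) = (\<Sum>x\<in>A. Pw a (f x))"
  by (induction A rule: infinite_finite_induct) (simp_all add: Pw_add)

lemma Pw_expand: "Pw a f = (\<Sum>e\<in>keys f. Pw a (ymon e))"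
  by (subst ypoly_expand[of f]) (simp add: Pw_sum ymon_def)

lemma lam_Pw:
  assumes "I \<subseteq> {1..n}" "a \<ge> 1" "f \<in> Yn n"
  shows "lam n k I (Pw a f) = 0"
  unfolding Pw_expand[of a f] lam_sum
  using assms by (intro sum.neutral ballI lam_Pw_ymon) (auto simp: Yn_def)

lemma Yn_0 [simp]: "0 \<in> Yn n"
  by (simp add: Yn_def)

lemma Yn_add: "f \<in> Yn n \<Longrightarrow> g \<in> Yn n \<Longrightarrow> f + g \<in> Yn n"
  using Poly_Mapping.keys_add[of f g] by (auto simp: Yn_def)

lemma Yn_sum: "(\<And>x. x \<in> A \<Longrightarrow> f x \<in> Yn n) \<Longrightarrow> (\<Sum>x\<in>A. f x) \<in> Yn n"
  by (induction A rule: infinite_finite_induct) (auto intro: Yn_add)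

lemma ymon_Yn: "ymon e \<in> Yn n \<longleftrightarrow> keys e \<subseteq> {1..n}"
  by (simp add: Yn_def ymon_def)

lemma Pw_Yn: "f \<in> Yn n \<Longrightarrow> Pw a f \<in> Yn n"
  unfolding Pw_expand[of a f]
proof (rule Yn_sum)
  fix e assume "f \<in> Yn n" "e \<in> keys f"
  then have "keys e \<subseteq> {1..n}" by (simp add: Yn_def)
  then show "Pw a (ymon e) \<in> Yn n"
    using ymon_Yn keys_expo[OF finite_atLeastAtMost]
    by (subst Pw_ymon[OF finite_atLeastAtMost]) (blast intro: Yn_sum)+
qed

text \<open>Used for \<open>P_plus\<close> and for \<open>A_plus\<close>, with H the kernel of a
  functional. The alternative \<open>u \<in> H\<close> carries the induction through composites: if
  the outer factor has degree 0, the inner one has positive degree and already lands in H, which the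
  outer one must preserve.\<close>

lemma graded_ops_image:
  assumes "graded_ops Gs r \<theta>"
    and gen: "\<And>r \<theta> u. (r, \<theta>) \<in> Gs \<Longrightarrow> u \<in> S \<Longrightarrow> r > 0 \<and> \<theta> u \<in> S \<and> \<theta> u \<in> H"
    and S: "0 \<in> S" "\<And>u v. u \<in> S \<Longrightarrow> v \<in> S \<Longrightarrow> u + v \<in> S"
    and H: "0 \<in> H" "\<And>u v. u \<in> H \<Longrightarrow> v \<in> H \<Longrightarrow> u + v \<in> H"
    and "u \<in> S"
  shows "\<theta> u \<in> S \<and> (r > 0 \<or> u \<in> H \<longrightarrow> \<theta> u \<in> H)"
  using assms(1,7)
proof (induction arbitrary: u rule: graded_ops.induct)
  case (comp r \<theta> s \<phi>)
  then show ?case by (metis add_gr_0 bot_nat_0.not_eq_extremum)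
qed (use gen S H in auto)

lemma lam_yspan_eq_0: "(\<And>f. f \<in> B \<Longrightarrow> lam n k I f = 0) \<Longrightarrow> f \<in> yspan B \<Longrightarrow> lam n k I f = 0"
  by (erule Y2.span_induct_alt) (auto simp: lam_add yscale_bit)

lemma Pw_P_plus:
  assumes "a \<ge> 1" "f \<in> Yn n"
  shows "Pw a f \<in> P_plus n"
  unfolding P_plus_def
proof (rule Y2.span_base, rule CollectI, intro exI conjI)
  show "graded_ops {(2 * a, Pw a) | a. a \<ge> 1} (2 * a) (Pw a)"
    using assms by (intro graded_ops.gen) auto
qed (use assms in auto)

lemma lam_P_plus:
  assumes "I \<subseteq> {1..n}" "f \<in> P_plus n"
  shows "lam n k I f = 0"
proof (rule lam_yspan_eq_0[OF _ assms(2)[unfolded P_plus_def]])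
  fix f assume "f \<in> {\<theta> f | \<theta> f. (\<exists>r>0. graded_ops {(2 * a, Pw a) | a. a \<ge> 1} r \<theta>) \<and> f \<in> Yn n}"
  then obtain \<theta> g r where *: "f = \<theta> g" "r > 0" "g \<in> Yn n"
    "graded_ops {(2 * a, Pw a) | a. a \<ge> 1} r \<theta>" by blast
  have "\<theta> g \<in> Yn n \<and> (r > 0 \<or> g \<in> {f. lam n k I f = 0} \<longrightarrow> \<theta> g \<in> {f. lam n k I f = 0})"
    by (rule graded_ops_image[OF *(4)])
      (use *(3) in \<open>auto simp: lam_add lam_Pw[OF assms(1)] intro: Yn_add Pw_Yn\<close>)
  then show "lam n k I f = 0" using * by auto
qed

section \<open>Weights, and vanishing on \<open>Gn\<close>\<close>

lemma omega_Suc: "omega n e (Suc j) = card {i \<in> {1..n}. odd (lookup e i div 2 ^ j)}"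
proof -
  \<comment> \<open>\<open>omega\<close> reads the digits of the doubled exponent, so index j+1 is
    digit j of the exponent itself.\<close>
  have "omega n e (Suc j) = (\<Sum>i=1..n. of_bool (odd (lookup e i div 2 ^ j)))"
    by (simp add: omega_def mod_2_eq_odd)
  then show ?thesis by (simp add: Int_def)
qed

lemma odd_bits_defexp:
  assumes "I \<subseteq> {1..n}" "bij_betw m I {..<k}" "j < k"
  shows "{i \<in> {1..n}. odd (lookup (defexp n k I m) i div 2 ^ j)} = {1..n} - {inv_into I m j}"
proof -
  have inv: "inv_into I m j \<in> I" "m (inv_into I m j) = j"
    using assms by (auto simp: bij_betw_def intro: inv_into_into f_inv_into_f)
  have "odd (lookup (defexp n k I m) i div 2 ^ j) \<longleftrightarrow> i \<noteq> inv_into I m j" if "i \<in> {1..n}" for i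
  proof (cases "i \<in> I")
    case True
    then have "m i < k" "m i = j \<longleftrightarrow> i = inv_into I m j"
      using assms inv by (auto simp: bij_betw_def)
    then show ?thesis
      unfolding lookup_defexp using that True assms(3) odd_ones_but_div[of "m i" k j] by auto
  next
    case False
    then show ?thesis
      unfolding lookup_defexp using that inv assms(3) odd_ones_div[of k j] by auto
  qed
  then show ?thesis by blast
qed

lemma omega_defexp:
  assumes "I \<subseteq> {1..n}" "bij_betw m I {..<k}" "j < k"
  shows "omega n (defexp n k I m) (Suc j) = n - 1"
proof -
  have "inv_into I m j \<in> {1..n}"
    using assms by (intro subsetD[OF assms(1)] inv_into_into) (auto simp: bij_betw_def)
  then show ?thesis unfolding omega_Suc odd_bits_defexp[OF assms] by (subst card_Diff_singleton) auto
qed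

text \<open>Lexicographic comparison is decided at p, the first position, counted from 0, where the
  weight leaves n-1.\<close>

lemma Gn_lower:
  assumes "keys e \<subseteq> {1..n}" "p < k"
    and "\<And>j. j < p \<Longrightarrow> omega n e (Suc j) = n - 1" "omega n e (Suc p) < n - 1"
  shows "ymon e \<in> Gn n k"
proof -
  have "[1..<k+1] = [1..<p+1] @ Suc p # [p+2..<k+1]"
    using assms(2) upt_add_eq_append[of 1 "p+1" "k - p"] by (simp add: upt_conv_Cons)
  moreover have "map (omega n e) [1..<p+1] = replicate p (n - 1)"
    using assms(3) by (intro nth_equalityI) (simp_all del: upt_Suc)
  moreover have "replicate k (n - 1) = replicate p (n - 1) @ (n - 1) # replicate (k - p - 1) (n - 1)"
    using assms(2) by (metis Suc_diff_Suc diff_Suc_1 le_add_diff_inverse less_imp_le_nat replicate_Suc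
        replicate_add diff_Suc_eq_diff_pred)
  ultimately have "(map (omega n e) [1..<k+1], replicate k (n - 1)) \<in> lex less_than"
    unfolding lex_conv using assms(2,4)
    by (auto intro!: exI[of _ "replicate p (n - 1)"] simp del: upt_Suc)
  then show ?thesis
    unfolding Gn_def by (intro Y2.span_base) (use assms(1) in auto)
qed

lemma lam_Gn:
  assumes "I \<subseteq> {1..n}" "f \<in> Gn n k"
  shows "lam n k I f = 0"
proof (rule lam_yspan_eq_0[OF _ assms(2)[unfolded Gn_def]])
  fix f assume f: "f \<in> P_plus n \<union> {ymon e | e. keys e \<subseteq> {1..n} \<and>
       (map (omega n e) [1..<k+1], replicate k (n - 1)) \<in> lex less_than}"
  show "lam n k I f = 0"
  proof (cases "f \<in> P_plus n")
    case True
    then show ?thesis by (rule lam_P_plus[OF assms(1)])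
  next
    case False
    then obtain e where e: "f = ymon e"
      "(map (omega n e) [1..<k+1], replicate k (n - 1)) \<in> lex less_than" using f by blast
    \<comment> \<open>All weights of a deficient exponent equal n-1, and the order is
      irreflexive.\<close>
    have "\<not> deficient n k I e"
    proof
      assume "deficient n k I e"
      then obtain m where "bij_betw m I {..<k}" "e = defexp n k I m" by (auto simp: deficient_def)
      then have "map (omega n e) [1..<k+1] = replicate k (n - 1)"
        using omega_defexp[OF assms(1)] by (intro nth_equalityI) (simp_all del: upt_Suc)
      then show False using e(2) by (simp only:) (auto simp: lex_conv)
    qed
    then show ?thesis by (simp add: e lam_ymon)
  qed
qed

lemma Gn_0: "0 \<in> Gn n k"
  by (simp add: Gn_def Y2.span_zero)

lemma Gn_add: "f \<in> Gn n k \<Longrightarrow> g \<in> Gn n k \<Longrightarrow> f + g \<in> Gn n k"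
  by (simp add: Gn_def Y2.span_add)

lemma Gn_sum: "(\<And>x. x \<in> A \<Longrightarrow> f x \<in> Gn n k) \<Longrightarrow> (\<Sum>x\<in>A. f x) \<in> Gn n k"
  by (simp add: Gn_def Y2.span_sum)

lemma P_plus_Gn: "f \<in> P_plus n \<Longrightarrow> f \<in> Gn n k"
  by (simp add: Gn_def Y2.span_base)

section \<open>Exchanging two neighbouring missing positions\<close>

lemma odd_add_dvd_div:
  assumes "2 ^ p dvd (h::nat)" "j \<le> p"
  shows "odd ((g + h) div 2 ^ j) \<longleftrightarrow> odd (g div 2 ^ j) \<noteq> odd (h div 2 ^ j)"
proof -
  have "2 ^ j dvd h" using assms by (meson dvd_trans le_imp_power_dvd)
  \<comment> \<open>h has no digits below p, so no carry enters a position up to p.\<close>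
  then have "(g + h) div 2 ^ j = g div 2 ^ j + h div 2 ^ j" by (rule div_plus_div_distrib_dvd_right)
  then show ?thesis by simp
qed

lemma even_dvd_div: "2 ^ p dvd (h::nat) \<Longrightarrow> j < p \<Longrightarrow> even (h div 2 ^ j)"
  by (metis Suc_leI dvd_div_iff_mult dvd_mult_imp_div le_imp_power_dvd dvd_trans power_Suc power_not_zero zero_neq_numeral)

text \<open>
  Applying \<open>\<P>\<close> to the monomial with the bit \<open>t\<close> filled up in all variables: the shifts
  other than \<open>2 ^ t\<close> at \<open>a\<close> or \<open>b\<close> clear too many bits at the first position where they act.
\<close>

lemma swap_adjacent:
  assumes I: "I \<subseteq> {1..n}" and m: "bij_betw m I {..<k}"
    and ab: "a \<in> I" "b \<in> I" "m a = t" "m b = Suc t"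
  shows "ymon (defexp n k I m) + ymon (defexp n k I (m(a := Suc t, b := t))) \<in> Gn n k"
proof -
  \<comment> \<open>Adding 2^t to \<open>ones_but k (Suc t)\<close> gives
    \<open>ones_but k t\<close> by a carry. In g both a and b lack \<open>Suc t\<close>: the shift
    at a restores m, the shift at b gives the exchanged assignment.\<close>
  define g where "g = expo {1..n} (\<lambda>i. if i = a then ones_but k (Suc t) else lookup (defexp n k I m) i)"
  let ?A = "{1..n}"
  let ?e = "\<lambda>h. expo ?A (\<lambda>i. lookup g i + h i)"
  let ?\<delta> = "\<lambda>c. \<lambda>i\<in>?A. if i = c then 2 ^ t else 0 :: nat"
  have keys: "keys g \<subseteq> ?A" unfolding g_def by (rule keys_expo) simp
  have tk: "Suc t < k" using m ab by (metis bij_betwE lessThan_iff)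
  have abn: "a \<in> ?A" "b \<in> ?A" "a \<noteq> b" using ab I by auto
  have inj: "inj_on m I" using m by (simp add: bij_betw_def)
  have mk: "i \<in> I \<Longrightarrow> m i < k" for i using m by (auto simp: bij_betw_def)
  have ma: "i \<in> I \<Longrightarrow> m i = t \<longleftrightarrow> i = a" and mb: "i \<in> I \<Longrightarrow> m i = Suc t \<longleftrightarrow> i = b" for i
    using inj ab by (auto simp: inj_on_def)
  have le: "(2::nat) ^ Suc t + 1 \<le> 2 ^ k" using two_power_less[OF tk] .
  have lg: "lookup g i = (if i = a then ones_but k (Suc t) else lookup (defexp n k I m) i)"
    if "i \<in> ?A" for i using that by (simp add: g_def lookup_expo)
  have bit: "odd (lookup g i div 2 ^ j) \<longleftrightarrow>
      (if i = a then j \<noteq> Suc t else i \<in> I \<longrightarrow> j \<noteq> m i)" if "i \<in> ?A" "j < k" for i j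
    using that mk tk unfolding lg[OF that(1)]
    by (auto simp: lookup_defexp odd_ones_but_div odd_ones_div simp del: power_Suc)
  have low: "{i \<in> ?A. odd (lookup g i div 2 ^ j)} =
      {i \<in> ?A. odd (lookup (defexp n k I m) i div 2 ^ j)}" if "j < t" for j
  proof -
    have "odd (lookup g i div 2 ^ j) \<longleftrightarrow> odd (lookup (defexp n k I m) i div 2 ^ j)"
      if "i \<in> ?A" for i
    proof -
      have "odd (ones_but k (Suc t) div 2 ^ j)" "odd (ones_but k t div 2 ^ j)"
        using odd_ones_but_div[of "Suc t" k j] odd_ones_but_div[of t k j] \<open>j < t\<close> tk by auto
      then show ?thesis using that ab unfolding lg[OF that] lookup_defexp by auto
    qed
    then show ?thesis by blast
  qed
  have omega_low: "omega n g (Suc j) = n - 1" if "j < t" for j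
    using omega_defexp[OF I m, of j] low[OF that] that tk by (simp only: omega_Suc)
  have e\<delta>: "?e (?\<delta> a) = defexp n k I m" "?e (?\<delta> b) = defexp n k I (m(a := Suc t, b := t))"
    using ab abn le by (auto intro!: poly_mapping_eqI simp: ones_but_def lookup_expo lg lookup_defexp)
  let ?S = "pow_shifts ?A g (2 ^ t)"
  have \<delta>S: "?\<delta> c \<in> ?S" if "c \<in> {a, b}" for c
  proof -
    have c: "c \<in> ?A" using that abn by blast
    have "odd (lookup g c choose 2 ^ t)"
      using bit[OF c, of t] that ab tk unfolding odd_choose_two_power by auto
    moreover from this have "2 ^ t \<le> lookup g c" by (metis binomial_eq_0 even_zero not_less)
    ultimately show ?thesis using c by (auto simp: pow_shifts_def)
  qed
  have "?\<delta> a a \<noteq> ?\<delta> b a" using abn by simp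
  then have \<delta>ab: "?\<delta> a \<noteq> ?\<delta> b" by (intro notI) (drule fun_cong, blast)
  have rest: "ymon (?e h) \<in> Gn n k" if hS: "h \<in> ?S - {?\<delta> a, ?\<delta> b}" for h
  proof -
    have h: "h \<in> PiE ?A (\<lambda>i. {..lookup g i})" "sum h ?A = 2 ^ t"
      "\<And>i. i \<in> ?A \<Longrightarrow> odd (lookup g i choose h i)"
      using hS by (auto simp: pow_shifts_def)
    have le: "lookup (?e h) i = lookup g i + h i" if "i \<in> ?A" for i
      using that by (simp add: lookup_expo)
    let ?P = "\<lambda>p. \<exists>i\<in>?A. \<not> 2 ^ Suc p dvd h i"
    have "?P t"
    proof (rule ccontr)
      assume "\<not> ?P t"
      then have "2 ^ Suc t dvd sum h ?A" by (intro dvd_sum) blast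
      then show False unfolding h(2) using power_dvd_imp_le[of "2::nat" "Suc t" t] by simp
    qed
    \<comment> \<open>The lowest position at which some h i has a digit. Below it the weights of g
      are unchanged.\<close>
    define p where "p = (LEAST p. ?P p)"
    have p: "?P p" "p \<le> t" unfolding p_def using \<open>?P t\<close> by (rule LeastI, rule Least_le)
    have dvd: "2 ^ p dvd h i" if "i \<in> ?A" for i
    proof (cases p)
      case (Suc q)
      then have "\<not> ?P q" unfolding p_def by (intro not_less_Least) simp
      then show ?thesis using that Suc by blast
    qed simp
    have odd_sum: "odd (lookup (?e h) i div 2 ^ j) \<longleftrightarrow>
        odd (lookup g i div 2 ^ j) \<noteq> odd (h i div 2 ^ j)" if "i \<in> ?A" "j \<le> p" for i j
      unfolding le[OF that(1)] using odd_add_dvd_div[OF dvd[OF that(1)] that(2)] .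
    have "{i \<in> ?A. odd (lookup (?e h) i div 2 ^ j)} = {i \<in> ?A. odd (lookup g i div 2 ^ j)}"
      if "j < p" for j
      using odd_sum[of _ j] even_dvd_div[OF dvd that] that by (intro Collect_cong) auto
    then have same: "omega n (?e h) (Suc j) = n - 1" if "j < p" for j
      using that omega_low[of j] p(2) by (simp only: omega_Suc)
    have keys_e: "keys (?e h) \<subseteq> ?A" by (rule keys_expo) simp
    obtain c where c: "c \<in> ?A" "\<not> 2 ^ Suc p dvd h c" using p(1) by blast
    have c_odd: "odd (h c div 2 ^ p)"
    proof
      assume "even (h c div 2 ^ p)"
      then have "2 * 2 ^ p dvd (h c div 2 ^ p) * 2 ^ p" by (intro mult_dvd_mono) auto
      then show False using c dvd[OF c(1)] by simp
    qed
    show ?thesis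
    proof (cases "p < t")
      case True
      \<comment> \<open>h uses only digits present in g, so at p digits are cleared and none is
        created; the digit of c is lost, which makes the weight drop.\<close>
      have hg: "odd (lookup g i div 2 ^ p)" if "i \<in> ?A" "odd (h i div 2 ^ p)" for i
        using odd_choose_halves(2)[OF odd_choose_div_power[OF h(3)[OF that(1)]] that(2)] .
      have "{i \<in> ?A. odd (lookup (?e h) i div 2 ^ p)} \<subset> {i \<in> ?A. odd (lookup g i div 2 ^ p)}"
        using odd_sum[of _ p] hg c(1) c_odd by blast
      then have "omega n (?e h) (Suc p) < omega n g (Suc p)"
        unfolding omega_Suc by (intro psubset_card_mono) auto
      then have "omega n (?e h) (Suc p) < n - 1" using omega_low[OF True] by (simp only:)
      moreover have "p < k" using True tk by simp
      ultimately show ?thesis using Gn_lower[OF keys_e _ same] by blast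
    next
      case False
      \<comment> \<open>Now h c exhausts the sum 2^t, so h is the shift at some c other than a and
        b. Position t had its digit in all n variables and keeps weight n-1; position t+1 is missing
        at both a and b and decides the comparison.\<close>
      then have pt: "p = t" using p(2) by simp
      have "h c \<noteq> 0" using c_odd by (metis div_0 even_zero)
      then have "2 ^ t \<le> h c" using dvd[OF c(1)] pt by (simp add: dvd_imp_le)
      moreover have "sum h ?A = h c + sum h (?A - {c})" using c(1) by (simp add: sum.remove)
      ultimately have hc: "h c = 2 ^ t" "sum h (?A - {c}) = 0" using h(2) by linarith+
      have h_eq: "h = ?\<delta> c"
      proof
        fix i show "h i = ?\<delta> c i"
          using hc PiE_arb[OF h(1), of i] by (cases "i \<in> ?A"; cases "i = c") auto
      qed
      then have cab: "c \<noteq> a" "c \<noteq> b" using hS by auto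
      have "odd (lookup g i div 2 ^ t)" if "i \<in> ?A" for i
        using bit[OF that, of t] tk ma[of i] by auto
      moreover have "odd (h i div 2 ^ t) \<longleftrightarrow> i = c" if "i \<in> ?A" for i
        unfolding h_eq using that by simp
      ultimately have "{i \<in> ?A. odd (lookup (?e h) i div 2 ^ t)} = ?A - {c}"
        using odd_sum[of _ t] pt by blast
      then have "omega n (?e h) (Suc t) = n - 1"
        unfolding omega_Suc using c(1) by simp
      then have same': "omega n (?e h) (Suc j) = n - 1" if "j < Suc t" for j
        using same[of j] that pt by (cases "j = t") auto
      have "lookup (?e h) i = lookup g i" if "i \<in> {a, b}" for i
        using that le[of i] abn cab unfolding h_eq by auto
      then have "{i \<in> ?A. odd (lookup (?e h) i div 2 ^ Suc t)} \<subseteq> ?A - {a, b}"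
        using bit[of a "Suc t"] bit[of b "Suc t"] abn ab tk by auto
      then have "omega n (?e h) (Suc (Suc t)) \<le> card (?A - {a, b})"
        unfolding omega_Suc by (intro card_mono) auto
      also have "\<dots> = n - 2" using abn by (subst card_Diff_subset) auto
      finally have "omega n (?e h) (Suc (Suc t)) < n - 1" using abn by auto
      then show ?thesis using Gn_lower[OF keys_e tk same'] by blast
    qed
  qed
  have pair: "(\<Sum>h\<in>{x, y}. F h) = F x + F y" if "x \<noteq> y"
    for x y :: "nat \<Rightarrow> nat" and F :: "_ \<Rightarrow> ypoly"
    using that by simp
  have "Pw (2 ^ t) (ymon g) = (\<Sum>h\<in>?S. ymon (?e h))"
    by (rule Pw_ymon[OF finite_atLeastAtMost keys])
  also have "\<dots> = (\<Sum>h\<in>{?\<delta> a, ?\<delta> b}. ymon (?e h)) + (\<Sum>h\<in>?S - {?\<delta> a, ?\<delta> b}. ymon (?e h))"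
    using \<delta>S by (subst sum.subset_diff[of "{?\<delta> a, ?\<delta> b}"]) (auto simp: finite_pow_shifts)
  also have "(\<Sum>h\<in>{?\<delta> a, ?\<delta> b}. ymon (?e h)) =
      ymon (defexp n k I m) + ymon (defexp n k I (m(a := Suc t, b := t)))"
    by (simp only: pair[OF \<delta>ab] e\<delta>)
  finally have "ymon (defexp n k I m) + ymon (defexp n k I (m(a := Suc t, b := t))) =
      Pw (2 ^ t) (ymon g) + (\<Sum>h\<in>?S - {?\<delta> a, ?\<delta> b}. ymon (?e h))"
    by (metis (no_types, lifting) add.assoc add.right_neutral ypoly_add_self)
  moreover have "Pw (2 ^ t) (ymon g) \<in> Gn n k"
    using keys by (intro P_plus_Gn Pw_P_plus) (auto simp: ymon_Yn)
  moreover have "(\<Sum>h\<in>?S - {?\<delta> a, ?\<delta> b}. ymon (?e h)) \<in> Gn n k"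
    by (rule Gn_sum) (rule rest)
  ultimately show ?thesis by (simp only: Gn_add)
qed

section \<open>Sorting the missing positions\<close>

lemma Mono_mapsD:
  assumes "\<sigma> \<in> Mono_maps n k"
  shows "inj_on \<sigma> {1..k}" "\<sigma> ` {1..k} \<subseteq> {1..n}" "card (\<sigma> ` {1..k}) = k"
proof -
  show inj: "inj_on \<sigma> {1..k}"
    using assms by (auto simp: Mono_maps_def intro: strict_mono_on_imp_inj_on)
  show "\<sigma> ` {1..k} \<subseteq> {1..n}" using assms by (auto simp: Mono_maps_def)
  show "card (\<sigma> ` {1..k}) = k" using inj by (simp add: card_image)
qed

text \<open>The exponent 2^k - 2^(k-j) - 1 of the variable \<open>\<sigma> j\<close> lacks position
  k-j; thus the missing positions decrease along increasing variables.\<close>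

lemma sigma_z_defexp:
  assumes \<sigma>: "\<sigma> \<in> Mono_maps n k" and m: "\<And>j. j \<in> {1..k} \<Longrightarrow> m (\<sigma> j) = k - j"
  shows "sigma_z n k \<sigma> = single (\<sigma> ` {1..k}) (ymon (defexp n k (\<sigma> ` {1..k}) m))"
proof -
  let ?I = "\<sigma> ` {1..k}"
  let ?x = "\<lambda>i. if i \<in> ?I then ones_but k (m i) else ones k"
  have "(\<Prod>j=1..k. yvar (\<sigma> j) ^ (2 ^ k - 2 ^ (k - j) - 1)) = (\<Prod>j=1..k. yvar (\<sigma> j) ^ ?x (\<sigma> j))"
    using m by (intro prod.cong refl) (auto simp: ones_but_def)
  also have "\<dots> = (\<Prod>i\<in>?I. yvar i ^ ?x i)"
    using prod.reindex[OF Mono_mapsD(1)[OF \<sigma>], of "\<lambda>i. yvar i ^ ?x i"] by simp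
  finally have 1: "(\<Prod>j=1..k. yvar (\<sigma> j) ^ (2 ^ k - 2 ^ (k - j) - 1)) = (\<Prod>i\<in>?I. yvar i ^ ?x i)" .
  have 2: "(\<Prod>i\<in>{1..n} - ?I. yvar i ^ (2 ^ k - 1)) = (\<Prod>i\<in>{1..n} - ?I. yvar i ^ ?x i)"
    by (intro prod.cong) (auto simp: ones_def)
  have "(\<Prod>i\<in>?I. yvar i ^ ?x i) * (\<Prod>i\<in>{1..n} - ?I. yvar i ^ ?x i) = (\<Prod>i\<in>{1..n}. yvar i ^ ?x i)"
    using prod.subset_diff[OF Mono_mapsD(2)[OF \<sigma>], of "\<lambda>i. yvar i ^ ?x i"] by (simp add: mult.commute)
  then show ?thesis
    unfolding sigma_z_def 1 2 by (simp only: prod_yvar_expo finite_atLeastAtMost defexp_def)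
qed

lemma sigma_z_deficient:
  assumes \<sigma>: "\<sigma> \<in> Mono_maps n k"
  shows "\<exists>e. deficient n k (\<sigma> ` {1..k}) e \<and> sigma_z n k \<sigma> = single (\<sigma> ` {1..k}) (ymon e)"
proof -
  define m where "m i = k - inv_into {1..k} \<sigma> i" for i
  note inj = Mono_mapsD(1)[OF \<sigma>]
  have m: "m (\<sigma> j) = k - j" if "j \<in> {1..k}" for j
    unfolding m_def using inv_into_f_f[OF inj that] by simp
  have "bij_betw m (\<sigma> ` {1..k}) {..<k}"
  proof (rule bij_betw_byWitness[where f' = "\<lambda>t. \<sigma> (k - t)"])
    show "\<forall>i\<in>\<sigma> ` {1..k}. \<sigma> (k - m i) = i"
    proof
      fix i assume "i \<in> \<sigma> ` {1..k}"
      then obtain j where j: "j \<in> {1..k}" "i = \<sigma> j" by blast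
      then show "\<sigma> (k - m i) = i" using m[OF j(1)] by simp
    qed
    show "\<forall>t\<in>{..<k}. m (\<sigma> (k - t)) = t" using m by simp
    show "m ` \<sigma> ` {1..k} \<subseteq> {..<k}" using m by auto
    show "(\<lambda>t. \<sigma> (k - t)) ` {..<k} \<subseteq> \<sigma> ` {1..k}" by auto
  qed
  then show ?thesis
    using sigma_z_defexp[of \<sigma> n k m] m \<sigma> unfolding deficient_def by blast
qed

lemma strict_antimono_lessThan:
  assumes "\<And>t. Suc t < k \<Longrightarrow> f (Suc t) < (f t :: nat)" "s < t" "t < k"
  shows "f t < f s"
  using assms(2,3)
proof (induction t)
  case (Suc t)
  then show ?case using assms(1)[of t] by (cases "s = t") (auto simp: less_Suc_eq)
qed simp

text \<open>Bubble sort towards decreasing \<open>m\<close>: each swap of an ascent lowers \<open>\<Sum>i\<in>I. i * m i\<close>.\<close>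

lemma defexp_sort:
  assumes I: "I \<subseteq> {1..n}" and m: "bij_betw m I {..<k}"
  shows "\<exists>\<sigma>\<in>Mono_maps n k. \<sigma> ` {1..k} = I \<and> (\<exists>e. sigma_z n k \<sigma> = single I (ymon e) \<and>
    ymon (defexp n k I m) + ymon e \<in> Gn n k)"
  using m
proof (induction "\<Sum>i\<in>I. i * m i" arbitrary: m rule: less_induct)
  case less
  note m = less.prems
  have fin: "finite I" using finite_subset[OF I] by simp
  show ?case
  \<comment> \<open>The ascents compare neighbouring positions, not neighbouring variables, because
    \<open>swap_adjacent\<close> exchanges exactly such positions.\<close>
  proof (cases "\<exists>a\<in>I. \<exists>b\<in>I. m b = Suc (m a) \<and> a < b")
    case True
    then obtain a b where ab: "a \<in> I" "b \<in> I" "m b = Suc (m a)" "a < b" by blast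
    define m' where "m' = m(a := Suc (m a), b := m a)"
    have m': "m' = m \<circ> transpose a b"
      using ab by (auto simp: m'_def fun_eq_iff transpose_def)
    have bij: "bij_betw m' I {..<k}"
      unfolding m' using ab
      by (intro bij_betw_trans[OF _ m] bij_betw_byWitness[where f' = "transpose a b"])
        (auto simp: transpose_def)
    have split: "(\<Sum>i\<in>I. i * f i) = a * f a + (b * f b + (\<Sum>i\<in>I - {a} - {b}. i * f i))" for f
      using ab fin by (simp add: sum.remove[of I a] sum.remove[of "I - {a}" b])
    have "(\<Sum>i\<in>I - {a} - {b}. i * m' i) = (\<Sum>i\<in>I - {a} - {b}. i * m i)"
      by (intro sum.cong) (auto simp: m'_def)
    \<comment> \<open>The exchange changes the sum by a - b.\<close>
    then have "(\<Sum>i\<in>I. i * m' i) < (\<Sum>i\<in>I. i * m i)"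
      using ab unfolding split by (simp add: m'_def)
    from less.hyps[OF this bij] obtain \<sigma> e where *: "\<sigma> \<in> Mono_maps n k" "\<sigma> ` {1..k} = I"
      "sigma_z n k \<sigma> = single I (ymon e)" "ymon (defexp n k I m') + ymon e \<in> Gn n k" by blast
    have "ymon (defexp n k I m) + ymon (defexp n k I m') \<in> Gn n k"
      unfolding m'_def using swap_adjacent[OF I m ab(1,2) refl ab(3)] .
    \<comment> \<open>The monomial of m' occurs twice and cancels.\<close>
    from Gn_add[OF this *(4)] have "ymon (defexp n k I m) + ymon e \<in> Gn n k"
      by (metis (no_types, lifting) add.assoc add.right_neutral add.commute ypoly_add_self)
    then show ?thesis using * by blast
  next
    case False
    define f where "f = inv_into I m"
    have f: "f t \<in> I" "m (f t) = t" if "t < k" for t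
      using m that by (auto simp: f_def bij_betw_def intro: inv_into_into f_inv_into_f)
    have anti: "f t < f s" if "s < t" "t < k" for s t
    proof (rule strict_antimono_lessThan[OF _ that])
      fix t assume t: "Suc t < k"
      then have "\<not> f t < f (Suc t)" using False f[of t] f[of "Suc t"] by auto
      moreover have "f t \<noteq> f (Suc t)" using f[of t] f[of "Suc t"] t by auto
      ultimately show "f (Suc t) < f t" by simp
    qed
    \<comment> \<open>\<open>\<sigma> j\<close> is the variable lacking position k-j, as in
      \<open>sigma_z\<close>. Without ascents f decreases, so \<sigma> increases.\<close>
    define \<sigma> where "\<sigma> = (\<lambda>j\<in>{1..k}. f (k - j))"
    have "\<sigma> \<in> {1..k} \<rightarrow>\<^sub>E {1..n}"
      unfolding \<sigma>_def using f(1) by (intro restrict_PiE_iff[THEN iffD2] ballI subsetD[OF I]) simp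
    moreover have "strict_mono_on {1..k} \<sigma>"
    proof (rule strict_mono_onI)
      fix r s assume "r \<in> {1..k}" "s \<in> {1..k}" "r < s"
      then show "\<sigma> r < \<sigma> s" using anti[of "k - s" "k - r"] by (simp add: \<sigma>_def)
    qed
    ultimately have \<sigma>: "\<sigma> \<in> Mono_maps n k" by (simp only: Mono_maps_def mem_Collect_eq simp_thms)
    have "I \<subseteq> \<sigma> ` {1..k}"
    proof
      fix i assume i: "i \<in> I"
      then have "m i < k" "f (m i) = i" using m by (auto simp: f_def bij_betw_def)
      then show "i \<in> \<sigma> ` {1..k}" by (intro image_eqI[of _ _ "k - m i"]) (auto simp: \<sigma>_def)
    qed
    moreover have "\<sigma> ` {1..k} \<subseteq> I" using f by (auto simp: \<sigma>_def)
    ultimately have img: "\<sigma> ` {1..k} = I" by blast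
    have "m (\<sigma> j) = k - j" if "j \<in> {1..k}" for j
      using f(2)[of "k - j"] that by (simp add: \<sigma>_def)
    from sigma_z_defexp[OF \<sigma> this] have "sigma_z n k \<sigma> = single I (ymon (defexp n k I m))"
      unfolding img by blast
    moreover have "ymon (defexp n k I m) + ymon (defexp n k I m) \<in> Gn n k"
      unfolding ypoly_add_self by (rule Gn_0)
    ultimately show ?thesis using \<sigma> img by blast
  qed
qed

text \<open>A finite set has only one strictly increasing enumeration; passing to lists makes this
  \<open>strict_sorted_equal\<close>.\<close>

lemma Mono_maps_eqI:
  assumes "\<sigma> \<in> Mono_maps n k" "\<tau> \<in> Mono_maps n k" "\<sigma> ` {1..k} = \<tau> ` {1..k}"
  shows "\<sigma> = \<tau>"
proof -
  have sorted: "sorted_wrt (<) (map \<rho> [1..<Suc k])" if "\<rho> \<in> Mono_maps n k" for \<rho>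
    using that unfolding sorted_wrt_map
    by (intro sorted_wrt_mono_rel[OF _ sorted_wrt_upt]) (auto simp: strict_mono_on_def Mono_maps_def)
  have "set (map \<rho> [1..<Suc k]) = \<rho> ` {1..k}" for \<rho> :: "nat \<Rightarrow> nat"
    by (simp only: set_map set_upt atLeastLessThanSuc_atLeastAtMost)
  then have "set (map \<sigma> [1..<Suc k]) = set (map \<tau> [1..<Suc k])" using assms(3) by simp
  then have "map \<sigma> [1..<Suc k] = map \<tau> [1..<Suc k]"
    by (rule strict_sorted_equal[OF sorted[OF assms(2)] sorted[OF assms(1)]])
  then have "\<forall>j\<in>{1..k}. \<sigma> j = \<tau> j" by (simp only: map_eq_conv set_upt atLeastLessThanSuc_atLeastAtMost)
  then show ?thesis
    using assms(1,2) by (intro PiE_ext[of \<sigma> "{1..k}" "\<lambda>_. {1..n}" \<tau>]) (auto simp: Mono_maps_def)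
qed

text \<open>The increasing enumeration of I is a by-product of sorting an arbitrary bijection onto
  {..<k}.\<close>

lemma Mono_maps_image:
  assumes "I \<subseteq> {1..n}" "card I = k"
  shows "\<exists>\<sigma>\<in>Mono_maps n k. \<sigma> ` {1..k} = I"
proof -
  have "finite I" using finite_subset[OF assms(1)] by simp
  then obtain m where "bij_betw m I {..<k}"
    using finite_same_card_bij[of I "{..<k}"] assms(2) by auto
  from defexp_sort[OF assms(1) this] show ?thesis by blast
qed

lemma finite_Mono_maps: "finite (Mono_maps n k)"
  unfolding Mono_maps_def by (rule finite_subset[OF _ finite_PiE[of "{1..k}" "\<lambda>_. {1..n}"]]) auto

section \<open>The parity of hits\<close>

definition k_subsets :: "nat \<Rightarrow> nat \<Rightarrow> nat set set"
  where "k_subsets n k = {I. I \<subseteq> {1..n} \<and> card I = k}"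

definition ell :: "nat \<Rightarrow> nat \<Rightarrow> nat set \<Rightarrow> nelt \<Rightarrow> bit"
  where "ell n k I u = lam n k I (lookup u I)"

text \<open>In degree \<open>dtop n k\<close> this is \<open>eps\<close> after
  \<open>vartheta\<close> (see \<open>eps_vartheta\<close>), described without reference to
  \<open>M0\<close> and extended to all degrees.\<close>

definition par :: "nat \<Rightarrow> nat \<Rightarrow> nelt \<Rightarrow> bit"
  where "par n k u = (\<Sum>I\<in>k_subsets n k. ell n k I u)"

lemma finite_k_subsets: "finite (k_subsets n k)"
  by (rule finite_subset[of _ "Pow {1..n}"]) (auto simp: k_subsets_def)

lemma ell_add: "ell n k I (u + v) = ell n k I u + ell n k I v"
  by (simp add: ell_def lookup_add lam_add)

lemma ell_0 [simp]: "ell n k I 0 = 0"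
  by (simp add: ell_def)

lemma ell_sum: "ell n k I (\<Sum>x\<in>A. f x) = (\<Sum>x\<in>A. ell n k I (f x))"
  by (induction A rule: infinite_finite_induct) (simp_all add: ell_add)

lemma ell_single:
  "ell n k I (single J (ymon e)) = (if J = I \<and> deficient n k J e then 1 else 0)"
  by (simp add: ell_def lookup_single lam_ymon when_def)

lemma par_add: "par n k (u + v) = par n k u + par n k v"
  by (simp only: par_def ell_add sum.distrib)

lemma par_0 [simp]: "par n k 0 = 0"
  by (simp add: par_def)

lemma par_sum: "par n k (\<Sum>x\<in>A. f x) = (\<Sum>x\<in>A. par n k (f x))"
  by (induction A rule: infinite_finite_induct) (simp_all add: par_add)

section \<open>The subspace N_n and its stability under the operations\<close>

lemma Nn_lookup: "u \<in> Nn n \<Longrightarrow> lookup u I \<in> Yn n"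
  by (cases "I \<in> keys u") (auto simp: Nn_def in_keys_iff)

lemma Nn_keys: "u \<in> Nn n \<Longrightarrow> lookup u I \<noteq> 0 \<Longrightarrow> I \<subseteq> {1..n}"
  by (auto simp: Nn_def in_keys_iff)

lemma NnI: "(\<And>I. lookup u I \<noteq> 0 \<Longrightarrow> I \<subseteq> {1..n}) \<Longrightarrow> (\<And>I. lookup u I \<in> Yn n) \<Longrightarrow> u \<in> Nn n"
  by (auto simp: Nn_def in_keys_iff)

lemma Nn_0 [simp]: "0 \<in> Nn n"
  by (simp add: Nn_def)

lemma Nn_add:
  assumes "u \<in> Nn n" "v \<in> Nn n"
  shows "u + v \<in> Nn n"
proof (rule NnI)
  fix I
  show "lookup (u + v) I \<in> Yn n"
    unfolding lookup_add by (intro Yn_add Nn_lookup assms)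
  assume "lookup (u + v) I \<noteq> 0"
  then have "lookup u I \<noteq> 0 \<or> lookup v I \<noteq> 0" by (auto simp: lookup_add)
  then show "I \<subseteq> {1..n}" using assms Nn_keys by blast
qed

lemma Nn_sum: "(\<And>x. x \<in> A \<Longrightarrow> f x \<in> Nn n) \<Longrightarrow> (\<Sum>x\<in>A. f x) \<in> Nn n"
  by (induction A rule: infinite_finite_induct) (auto intro: Nn_add)

lemma Nn_single: "I \<subseteq> {1..n} \<Longrightarrow> f \<in> Yn n \<Longrightarrow> single I f \<in> Nn n"
  by (intro NnI) (auto simp: lookup_single when_def split: if_splits)

lemma PN_Nn:
  assumes "u \<in> Nn n"
  shows "PN a u \<in> Nn n"
proof (rule NnI)
  fix I
  show "lookup (PN a u) I \<in> Yn n"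
    unfolding lookup_PN by (intro Pw_Yn Nn_lookup assms)
  assume "lookup (PN a u) I \<noteq> 0"
  then have "lookup u I \<noteq> 0" by (auto simp: lookup_PN)
  then show "I \<subseteq> {1..n}" using assms Nn_keys by blast
qed

lemma yvar_ymon: "yvar i * ymon e = ymon (e + single i 1)"
  by (simp add: yvar_def ymon_def mult_single add.commute)

lemma Q0_expand: "Q0 u = (\<Sum>J\<in>keys u. \<Sum>e\<in>keys (lookup u J). Q0 (single J (ymon e)))"
proof -
  have "Q0 u = Q0 (\<Sum>J\<in>keys u. single J (lookup u J))" by (simp add: sum_singles)
  also have "\<dots> = (\<Sum>J\<in>keys u. Q0 (single J (lookup u J)))" by (rule Q0_sum)
  also have "\<dots> = (\<Sum>J\<in>keys u. \<Sum>e\<in>keys (lookup u J). Q0 (single J (ymon e)))"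
  proof (rule sum.cong[OF refl])
    fix J :: "nat set"
    have "single J (\<Sum>e\<in>A. ymon e) = (\<Sum>e\<in>A. single J (ymon e))" for A
      by (induction A rule: infinite_finite_induct) (simp_all add: single_add)
    then have "single J (lookup u J) = (\<Sum>e\<in>keys (lookup u J). single J (ymon e))"
      using ypoly_expand[of "lookup u J"] by (metis (no_types, lifting) ymon_def sum.cong)
    then show "Q0 (single J (lookup u J)) = (\<Sum>e\<in>keys (lookup u J). Q0 (single J (ymon e)))"
      by (simp add: Q0_sum)
  qed
  finally show ?thesis .
qed

lemma Q0_single_ymon:
  "Q0 (single J (ymon e)) = (\<Sum>i\<in>J. single (J - {i}) (ymon (e + single i 1)))"
  by (simp only: Q0_single yvar_ymon)

lemma keys_add_single: "keys e \<subseteq> {1..n} \<Longrightarrow> i \<in> {1..n} \<Longrightarrow> keys (e + single i 1) \<subseteq> {1..n}"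
  by (rule subset_trans[OF Poly_Mapping.keys_add]) (simp del: One_nat_def)

lemma Q0_Nn: "u \<in> Nn n \<Longrightarrow> Q0 u \<in> Nn n"
  unfolding Q0_expand[of u]
proof (intro Nn_sum)
  fix J e assume "u \<in> Nn n" "J \<in> keys u" "e \<in> keys (lookup u J)"
  then have "J \<subseteq> {1..n}" "keys e \<subseteq> {1..n}" by (auto simp: Nn_def Yn_def)
  then show "Q0 (single J (ymon e)) \<in> Nn n"
    unfolding Q0_single_ymon
    using keys_add_single[of e n] by (intro Nn_sum Nn_single) (auto simp: ymon_Yn simp del: One_nat_def atLeastAtMost_iff)
qed

text \<open>
  The exponent of \<open>a\<close> in \<open>e\<close> lacks position \<open>0\<close>, like that of \<open>b\<close>; increasing either of the two
  leaves a bijective distribution of the missing positions over the rest of \<open>J\<close>.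
\<close>

lemma boundary_deficient:
  assumes J: "J \<subseteq> {1..n}" and k: "k \<ge> 1" and a: "a \<in> J"
    and m: "bij_betw m (J - {a}) {..<k}" "e + single a 1 = defexp n k (J - {a}) m"
    and b: "b \<in> J - {a}" "m b = 0"
  shows "{i \<in> J. deficient n k (J - {i}) (e + single i 1)} = {a, b}"
proof -
  have pos: "(2::nat) ^ k \<ge> 2" using k power_increasing[of 1 k "2::nat"] by simp
  have ob: "ones_but k 0 = ones k - 1" by (simp add: ones_but_def ones_def)
  \<comment> \<open>a lies outside J - {a}, so its exponent is all ones after the increment.\<close>
  have eJ: "lookup e a = ones k - 1"
    using arg_cong[OF m(2), of "\<lambda>e. lookup e a"] a J by (auto simp: lookup_add lookup_defexp)
  have e: "lookup e i = lookup (defexp n k (J - {a}) m) i" if "i \<noteq> a" for i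
    using arg_cong[OF m(2), of "\<lambda>e. lookup e i"] that by (simp add: lookup_add lookup_single when_def)
  have "deficient n k (J - {a}) (e + single a 1)" using m by (auto simp: deficient_def)
  moreover have "deficient n k (J - {b}) (e + single b 1)"
    unfolding deficient_def
  proof (intro exI conjI)
    \<comment> \<open>b becomes the removed variable and a inherits its missing position 0.\<close>
    have "bij_betw (transpose a b) (J - {b}) (J - {a})"
      using a b by (intro bij_betw_byWitness[where f' = "transpose a b"]) (auto simp: transpose_def)
    then show "bij_betw (m \<circ> transpose a b) (J - {b}) {..<k}" using m(1) by (rule bij_betw_trans)
    show "e + single b 1 = defexp n k (J - {b}) (m \<circ> transpose a b)"
    proof (rule poly_mapping_eqI)
      fix i
      consider "i = a" | "i = b" | "i \<noteq> a" "i \<noteq> b" by blast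
      then show "lookup (e + single b 1) i = lookup (defexp n k (J - {b}) (m \<circ> transpose a b)) i"
      proof cases
        case 1
        then show ?thesis
          using a b J eJ ob by (auto simp: lookup_add lookup_single lookup_defexp)
      next
        case 2
        then show ?thesis
          using a b J e[of b] ob pos by (auto simp: lookup_add lookup_defexp ones_def)
      next
        case 3
        then show ?thesis
          using e[of i] by (auto simp: lookup_add lookup_single lookup_defexp)
      qed
    qed
  qed
  \<comment> \<open>A visible i has its gap in e at position 0, and within J - {a} only b has that
    gap.\<close>
  moreover have "i = b" if i: "i \<in> J" "deficient n k (J - {i}) (e + single i 1)" "i \<noteq> a" for i
  proof -
    from i(2) obtain m' where "e + single i 1 = defexp n k (J - {i}) m'"
      by (auto simp: deficient_def)
    from arg_cong[OF this, of "\<lambda>e. lookup e i"] have "lookup e i = ones_but k 0"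
      using i J by (auto simp: lookup_add lookup_defexp ob)
    then have "ones_but k (m i) = ones_but k 0" using e[OF i(3)] i J by (auto simp: lookup_defexp)
    moreover have "m i < k" using m(1) i by (auto simp: bij_betw_def)
    ultimately have "m i = m b"
      using k b by (auto dest: inj_onD[OF inj_on_ones_but])
    then show "i = b" using m(1) i b by (auto simp: bij_betw_def inj_on_def)
  qed
  ultimately show ?thesis using a b by blast
qed

lemma par_Q0_ymon:
  assumes J: "J \<subseteq> {1..n}" and k: "k \<ge> 1"
  shows "par n k (Q0 (single J (ymon e))) = 0"
proof -
  let ?S = "{i \<in> J. deficient n k (J - {i}) (e + single i 1)}"
  have fin: "finite J" using finite_subset[OF J] by simp
  have "card (J - {i}) = k" if "deficient n k (J - {i}) (e + single i 1)" for i
    using that by (auto simp: deficient_def dest: bij_betw_same_card)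
  then have sub: "J - {i} \<in> k_subsets n k" if "deficient n k (J - {i}) (e + single i 1)" for i
    using that J by (auto simp: k_subsets_def)
  \<comment> \<open>Only the functional of J - {i} can see this summand, and if it does, J - {i} has
    k elements and takes part in \<open>par\<close>.\<close>
  have "par n k (single (J - {i}) (ymon (e + single i 1))) =
      (if deficient n k (J - {i}) (e + single i 1) then 1 else 0)" for i
    unfolding par_def ell_single using sub[of i]
    by (auto simp: finite_k_subsets sum.delta' if_distrib cong: if_cong)
  then have "par n k (Q0 (single J (ymon e))) = of_nat (card ?S)"
    using fin by (simp add: Q0_single_ymon par_sum sum.If_cases Int_def)
  moreover have "even (card ?S)"
  proof (cases "?S = {}")
    case False
    then obtain a m where a: "a \<in> J" "bij_betw m (J - {a}) {..<k}"
      "e + single a 1 = defexp n k (J - {a}) m" by (auto simp: deficient_def)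
    have "0 \<in> m ` (J - {a})" using a(2) k by (auto simp: bij_betw_def)
    then obtain b where b: "b \<in> J - {a}" "m b = 0" by (metis imageE)
    then show ?thesis unfolding boundary_deficient[OF J k a b] by auto
  qed (simp only: card.empty even_zero)
  ultimately show ?thesis by (simp add: bit_of_nat)
qed

lemma par_Q0:
  assumes "k \<ge> 1" "u \<in> Nn n"
  shows "par n k (Q0 u) = 0"
  unfolding Q0_expand[of u] par_sum
  using assms by (intro sum.neutral ballI par_Q0_ymon) (auto simp: Nn_def)

lemma par_PN: "a \<ge> 1 \<Longrightarrow> u \<in> Nn n \<Longrightarrow> par n k (PN a u) = 0"
  unfolding par_def ell_def lookup_PN
  by (intro sum.neutral ballI lam_Pw) (auto simp: k_subsets_def Nn_lookup)

lemma par_A_plus: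
  assumes "k \<ge> 1" "u \<in> A_plus n"
  shows "par n k u = 0"
  using assms(2) unfolding A_plus_def
proof (induction rule: N2.span_induct_alt)
  case (step c v w)
  then obtain \<theta> x r where *: "v = \<theta> x" "r > 0" "x \<in> Nn n"
    "graded_ops (insert (1, Q0) {(2 * a, PN a) | a. a \<ge> 1}) r \<theta>"
    by (auto simp: A_sharp_def)
  have "\<theta> x \<in> Nn n \<and> (r > 0 \<or> x \<in> {u. par n k u = 0} \<longrightarrow> \<theta> x \<in> {u. par n k u = 0})"
    by (rule graded_ops_image[OF *(4)])
      (use *(3) assms(1) in \<open>auto simp: par_add par_PN par_Q0 intro: Nn_add PN_Nn Q0_Nn\<close>)
  then have "par n k v = 0" using * by auto
  moreover have "nscale c v = v \<or> nscale c v = 0" by (cases c) auto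
  ultimately show ?case using step by (auto simp: par_add)
qed simp

section \<open>Realising every even family of index sets by a hit\<close>

lemma sum_ones_but: "(\<Sum>j<k. ones_but k j) + ones k = k * ones k"
proof -
  have "(\<Sum>j<k. (2::nat) ^ j) = ones k" unfolding ones_def by (induction k) auto
  moreover have "(\<Sum>j<k. ones_but k j + 2 ^ j) = (\<Sum>j<k. ones k)"
    using two_power_less by (intro sum.cong) (force simp: ones_but_def ones_def)+
  ultimately show ?thesis by (simp add: sum.distrib)
qed

text \<open>Each position 0, ..., k-1 is missing once, which costs 2^k - 1 altogether against n(2^k
  - 1). This is the origin of the degree \<open>d1\<close>.\<close>

lemma mdeg_defexp:
  assumes I: "I \<subseteq> {1..n}" and m: "bij_betw m I {..<k}"
  shows "mdeg (defexp n k I m) = d1 n k"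
proof -
  let ?x = "\<lambda>i. if i \<in> I then ones_but k (m i) else ones k"
  have fin: "finite I" using finite_subset[OF I] by simp
  have "card I = k" using bij_betw_same_card[OF m] by simp
  then have card: "card ({1..n} - I) = n - k" "k \<le> n"
    using card_Diff_subset[OF fin I] card_mono[OF _ I] by auto
  have "mdeg (defexp n k I m) = sum ?x {1..n}"
    by (simp only: defexp_def mdeg_expo finite_atLeastAtMost)
  also have "\<dots> = sum ?x ({1..n} - I) + sum ?x I"
    using I by (simp add: sum.subset_diff)
  also have "sum ?x I = (\<Sum>i\<in>I. ones_but k (m i))" by simp
  also have "\<dots> = (\<Sum>j<k. ones_but k j)" by (rule sum.reindex_bij_betw[OF m])
  also have "sum ?x ({1..n} - I) = (n - k) * ones k" using card by simp
  finally have "mdeg (defexp n k I m) + ones k = (n - k) * ones k + k * ones k"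
    using sum_ones_but[of k] by simp
  also have "\<dots> = n * ones k" using card(2) by (simp flip: distrib_right)
  finally have "mdeg (defexp n k I m) = n * ones k - ones k" by linarith
  then show ?thesis by (simp only: d1_def diff_mult_distrib mult_1 flip: ones_def)
qed

lemma Ntop_0: "0 \<in> Ntop n d"
  by (simp add: Ntop_def)

lemma Ntop_add:
  assumes "u \<in> Ntop n d" "v \<in> Ntop n d"
  shows "u + v \<in> Ntop n d"
proof -
  have "card I + 2 * mdeg e = d" if "e \<in> keys (lookup (u + v) I)" for I e
  proof -
    have "e \<in> keys (lookup u I) \<or> e \<in> keys (lookup v I)"
      using that Poly_Mapping.keys_add[of "lookup u I" "lookup v I"] by (auto simp: lookup_add)
    moreover have "I \<in> keys w" if "e \<in> keys (lookup w I)" for w :: nelt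
      using that by (auto simp: in_keys_iff)
    ultimately show ?thesis using assms by (auto simp: Ntop_def)
  qed
  then show ?thesis using assms by (auto simp: Ntop_def Nn_add)
qed

lemma Ntop_sum: "(\<And>x. x \<in> A \<Longrightarrow> f x \<in> Ntop n d) \<Longrightarrow> (\<Sum>x\<in>A. f x) \<in> Ntop n d"
  by (induction A rule: infinite_finite_induct) (auto intro: Ntop_add Ntop_0)

lemma Ntop_single:
  "I \<subseteq> {1..n} \<Longrightarrow> keys e \<subseteq> {1..n} \<Longrightarrow> card I + 2 * mdeg e = d \<Longrightarrow> single I (ymon e) \<in> Ntop n d"
  unfolding Ntop_def using Nn_single[of I n "ymon e"]
  by (auto simp: ymon_Yn simp del: One_nat_def) (auto simp: ymon_def)

text \<open>The index sets with nonzero coefficient in \<open>\<vartheta>(u)\<close> for some hit \<open>u\<close>.\<close>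

definition hit_set :: "nat \<Rightarrow> nat \<Rightarrow> nat set set \<Rightarrow> bool"
  where "hit_set n k T \<longleftrightarrow> (\<exists>u \<in> A_plus n \<inter> Ntop n (dtop n k).
    \<forall>I\<in>k_subsets n k. ell n k I u = (if I \<in> T then 1 else 0))"

lemma hit_set_empty: "hit_set n k {}"
  unfolding hit_set_def by (intro bexI[of _ 0]) (auto simp: A_plus_def N2.span_zero Ntop_0)

lemma hit_set_sym_diff:
  assumes "hit_set n k S" "hit_set n k T"
  shows "hit_set n k (sym_diff S T)"
proof -
  obtain u v where u: "u \<in> A_plus n \<inter> Ntop n (dtop n k)" "v \<in> A_plus n \<inter> Ntop n (dtop n k)"
    and ell: "\<And>I. I \<in> k_subsets n k \<Longrightarrow> ell n k I u = (if I \<in> S then 1 else 0)"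
    "\<And>I. I \<in> k_subsets n k \<Longrightarrow> ell n k I v = (if I \<in> T then 1 else 0)"
    using assms unfolding hit_set_def by blast
  have "ell n k I (u + v) = (if I \<in> sym_diff S T then 1 else 0)" if "I \<in> k_subsets n k" for I
    unfolding ell_add ell[OF that] by simp
  moreover have "u + v \<in> A_plus n \<inter> Ntop n (dtop n k)"
    using u by (simp add: Ntop_add A_plus_def N2.span_add)
  ultimately show ?thesis unfolding hit_set_def by blast
qed

text \<open>The hit is \<open>Q0\<close> of a monomial over x_J in which a and b both lack position
  0, while the other k-1 variables of J lack the positions 1, ..., k-1, one each. By
  \<open>boundary_deficient\<close> exactly the summands of a and b are visible.\<close>

lemma hit_set_exchange:
  assumes J: "J \<subseteq> {1..n}" "card J = Suc k" and k: "k \<ge> 1" and ab: "a \<in> J" "b \<in> J" "a \<noteq> b"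
  shows "hit_set n k {J - {a}, J - {b}}"
proof -
  have fin: "finite J" using finite_subset[OF J(1)] by simp
  have "card (J - {a} - {b}) = card {1..<k}" using J(2) ab fin by simp
  then obtain m0 where m0: "bij_betw m0 (J - {a} - {b}) {1..<k}"
    using finite_same_card_bij[of "J - {a} - {b}" "{1..<k}"] fin by auto
  define m where "m = m0(b := 0)"
  have "bij_betw m (J - {a} - {b}) {1..<k}"
    using m0 by (subst bij_betw_cong[of _ _ m0]) (auto simp: m_def)
  then have "bij_betw m ((J - {a} - {b}) \<union> {b}) ({1..<k} \<union> {0})"
    by (rule bij_betw_combine) (auto simp: m_def)
  moreover have "(J - {a} - {b}) \<union> {b} = J - {a}" "{1..<k} \<union> {0} = {..<k}" using ab k by auto
  ultimately have m: "bij_betw m (J - {a}) {..<k}" by simp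
  \<comment> \<open>Since a is not in J - {a}, its exponent in \<open>defexp\<close> is all ones;
    one less clears position 0, and the increment at a gives back m.\<close>
  define e where "e = expo {1..n} (\<lambda>i. if i = a then ones k - 1 else lookup (defexp n k (J - {a}) m) i)"
  have pos: "(2::nat) ^ k \<ge> 2" using k power_increasing[of 1 k "2::nat"] by simp
  have ea: "e + single a 1 = defexp n k (J - {a}) m"
  proof (rule poly_mapping_eqI)
    fix i
    show "lookup (e + single a 1) i = lookup (defexp n k (J - {a}) m) i"
    proof (cases "i = a")
      case True
      have "a \<in> {1..n}" using ab J(1) by blast
      then show ?thesis
        using True pos unfolding lookup_add e_def lookup_expo[OF finite_atLeastAtMost] lookup_defexp
        by (simp add: ones_def)
    next
      case False
      then show ?thesis
        unfolding lookup_add e_def lookup_expo[OF finite_atLeastAtMost] lookup_defexp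
        by (simp add: lookup_single)
    qed
  qed
  have keys: "keys e \<subseteq> {1..n}" unfolding e_def by (rule keys_expo) simp
  let ?D = "{i \<in> J. deficient n k (J - {i}) (e + single i 1)}"
  let ?u = "Q0 (single J (ymon e))"
  have D: "?D = {a, b}"
    by (rule boundary_deficient[OF J(1) k ab(1) m ea]) (use ab in \<open>auto simp: m_def\<close>)
  have mdeg_add: "mdeg (e + single i 1) = mdeg e + 1" if "i \<in> {1..n}" for i
  proof -
    have "mdeg (e + single i 1) = (\<Sum>j\<in>{1..n}. lookup e j + (if j = i then 1 else 0))"
      by (subst mdeg_superset[OF finite_atLeastAtMost keys_add_single[OF keys that]])
        (auto simp: lookup_add lookup_single when_def intro!: sum.cong)
    then show ?thesis
      using that by (simp add: sum.distrib mdeg_superset[OF finite_atLeastAtMost keys] del: One_nat_def)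
  qed
  have "mdeg (e + single a 1) = d1 n k"
    unfolding ea using J(1) by (intro mdeg_defexp[OF _ m]) auto
  then have deg: "mdeg (e + single i 1) = d1 n k" if "i \<in> J" for i
    using mdeg_add[OF subsetD[OF J(1) that]] mdeg_add[OF subsetD[OF J(1) ab(1)]] by simp
  have "?u \<in> Ntop n (dtop n k)"
    unfolding Q0_single_ymon
  proof (rule Ntop_sum)
    fix i assume i: "i \<in> J"
    show "single (J - {i}) (ymon (e + single i 1)) \<in> Ntop n (dtop n k)"
    proof (rule Ntop_single)
      show "J - {i} \<subseteq> {1..n}" using J(1) by blast
      show "keys (e + single i 1) \<subseteq> {1..n}" using keys_add_single[OF keys] J(1) i by blast
      show "card (J - {i}) + 2 * mdeg (e + single i 1) = dtop n k"
        using i J(2) fin deg[OF i] by (simp add: dtop_def)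
    qed
  qed
  moreover have "?u \<in> A_plus n"
    unfolding A_plus_def
  proof (rule N2.span_base, rule CollectI, intro exI conjI)
    show "A_sharp 1 Q0" unfolding A_sharp_def by (intro graded_ops.gen) auto
    show "single J (ymon e) \<in> Nn n" using J(1) keys by (intro Nn_single) (simp_all add: ymon_Yn)
  qed auto
  moreover have "ell n k I ?u = (if I \<in> {J - {a}, J - {b}} then 1 else 0)" for I
  proof -
    have "ell n k I ?u = (\<Sum>i\<in>J. if i \<in> ?D then (if J - {i} = I then 1 else 0) else 0)"
      unfolding Q0_single_ymon ell_sum ell_single by (intro sum.cong) auto
    also have "\<dots> = (\<Sum>i\<in>?D. if J - {i} = I then 1 else 0)"
      using fin by (intro sum.mono_neutral_cong_right) auto
    also have "\<dots> = (if I \<in> {J - {a}, J - {b}} then 1 else 0)"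
      unfolding D using ab by auto
    finally show ?thesis .
  qed
  ultimately show ?thesis unfolding hit_set_def by blast
qed

text \<open>Two index sets are joined by a chain of single exchanges, and the intermediate sets
  cancel. The symmetric difference turns the case \<open>I = I'\<close> into the empty family
  instead of a single set.\<close>

lemma hit_set_pair:
  assumes k: "k \<ge> 1" and "I \<in> k_subsets n k" "I' \<in> k_subsets n k"
  shows "hit_set n k (sym_diff {I} {I'})"
  using assms(2)
proof (induction "card (I - I')" arbitrary: I rule: less_induct)
  case less
  have fin: "finite I" "finite I'" and card: "card I = card I'"
    using less.prems assms(3) finite_subset[OF _ finite_atLeastAtMost[of 1 n]]
    by (simp_all add: k_subsets_def)
  show ?case
  proof (cases "I = I'")
    case True
    then show ?thesis by (simp add: hit_set_empty)
  next
    case False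
    then have "\<not> I \<subseteq> I'" "\<not> I' \<subseteq> I"
      using card_subset_eq[OF fin(2), of I] card_subset_eq[OF fin(1), of I'] card by auto
    then obtain i i' where i: "i \<in> I" "i \<notin> I'" "i' \<in> I'" "i' \<notin> I" by blast
    let ?J = "insert i' I" and ?I2 = "insert i' I - {i}"
    have J: "?J \<subseteq> {1..n}" "card ?J = Suc k"
      using less.prems assms(3) i fin by (auto simp: k_subsets_def)
    have "?I2 \<in> k_subsets n k" using J i fin by (auto simp: k_subsets_def)
    moreover have "card (?I2 - I') < card (I - I')"
    proof (rule psubset_card_mono)
      show "?I2 - I' \<subset> I - I'" using i by blast
    qed (use fin in simp)
    ultimately have step: "hit_set n k (sym_diff {?I2} {I'})" by (intro less.hyps)
    have eq: "?J - {i'} = I" using i by blast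
    have exchange: "hit_set n k {?J - {i'}, ?J - {i}}"
      using i by (intro hit_set_exchange[OF J k]) auto
    have "?I2 \<noteq> I" using i by blast
    \<comment> \<open>This covers the last link of the chain too, where \<open>?I2 = I'\<close> and
      the inner difference is empty.\<close>
    then have "sym_diff {I, ?I2} (sym_diff {?I2} {I'}) = sym_diff {I} {I'}"
      using False by blast
    then show ?thesis
      using hit_set_sym_diff[OF exchange[unfolded eq] step] by (simp only:)
  qed
qed

lemma hit_set_even:
  assumes k: "k \<ge> 1" and "T \<subseteq> k_subsets n k" "even (card T)"
  shows "hit_set n k T"
  using assms(2,3)
proof (induction "card T" arbitrary: T rule: less_induct)
  case less
  have fin: "finite T" using less.prems finite_k_subsets by (metis finite_subset)
  show ?case
  proof (cases "T = {}")
    case False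
    then obtain I where I: "I \<in> T" by blast
    have "T \<noteq> {I}"
    proof
      assume "T = {I}"
      then have "card T = 1" by simp
      then show False using less.prems(2) by simp
    qed
    then obtain I' where I': "I' \<in> T" "I' \<noteq> I" using I by blast
    have card: "card T = card (T - {I, I'}) + 2"
    proof -
      have sub: "{I, I'} \<subseteq> T" using I I' by blast
      then have "card (T - {I, I'}) = card T - card {I, I'}" by (intro card_Diff_subset) auto
      moreover have "card {I, I'} \<le> card T" using sub by (rule card_mono[OF fin])
      ultimately show ?thesis using I' by simp
    qed
    have "hit_set n k (T - {I, I'})"
    proof (rule less.hyps)
      show "card (T - {I, I'}) < card T" "even (card (T - {I, I'}))"
        using card less.prems(2) by simp_all
      show "T - {I, I'} \<subseteq> k_subsets n k" using less.prems(1) by blast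
    qed
    moreover have "hit_set n k (sym_diff {I} {I'})"
      using less.prems(1) I I' by (intro hit_set_pair k) blast+
    ultimately have "hit_set n k (sym_diff (T - {I, I'}) (sym_diff {I} {I'}))"
      by (rule hit_set_sym_diff)
    moreover have "sym_diff (T - {I, I'}) (sym_diff {I} {I'}) = T"
      using I I' by blast
    ultimately show ?thesis by (simp only:)
  qed (simp add: hit_set_empty)
qed

section \<open>The quotient space and the local projection\<close>

lemma nelt_uminus: "- u = (u :: nelt)"
  by (rule minus_unique) (rule nelt_add_self)

text \<open>The common part is counted twice and cancels in characteristic 2. This allows linear
  combinations over the two-element field to be handled as finite sets.\<close>

lemma sum_sym_diff_nelt:
  fixes f :: "'a \<Rightarrow> nelt"
  assumes "finite A" "finite B"
  shows "sum f (sym_diff A B) = sum f A + sum f B"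
proof -
  have A: "sum f A = sum f (A \<inter> B) + sum f (A - B)" by (rule sum.Int_Diff[OF assms(1)])
  have B: "sum f B = sum f (A \<inter> B) + sum f (B - A)"
    by (subst Int_commute) (rule sum.Int_Diff[OF assms(2)])
  have "sum f A + sum f B = (sum f (A \<inter> B) + sum f (A \<inter> B)) + (sum f (A - B) + sum f (B - A))"
    unfolding A B by (simp only: ac_simps)
  also have "\<dots> = sum f (A - B) + sum f (B - A)" by (simp only: nelt_add_self add_0_left)
  also have "\<dots> = sum f (sym_diff A B)"
    using assms by (intro sum.union_disjoint[symmetric]) blast+
  finally show ?thesis by (rule sym)
qed

lemma comm_group_additive_group:
  assumes "0 \<in> A" "\<And>x y. x \<in> A \<Longrightarrow> y \<in> A \<Longrightarrow> x + y \<in> A" "\<And>x. x \<in> A \<Longrightarrow> - x \<in> A"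
  shows "comm_group (additive_group A)"
proof (rule comm_groupI)
  fix x assume "x \<in> carrier (additive_group A)"
  then show "\<exists>y\<in>carrier (additive_group A). y \<otimes>\<^bsub>additive_group A\<^esub> x = \<one>\<^bsub>additive_group A\<^esub>"
    using assms(3)[of x] by (intro bexI[of _ "- x"]) (simp_all add: additive_group_def)
qed (use assms in \<open>simp_all add: additive_group_def ac_simps\<close>)

lemma comm_group_F2: "comm_group F2"
  by (rule comm_group_additive_group) auto

section \<open>The quotient group and its generated subgroups\<close>

lemma Yhom_0 [simp]: "0 \<in> Yhom n b"
  by (simp add: Yhom_def)

lemma Yhom_add: "f \<in> Yhom n b \<Longrightarrow> g \<in> Yhom n b \<Longrightarrow> f + g \<in> Yhom n b"
  using Poly_Mapping.keys_add[of f g] Yn_add[of f n g] unfolding Yhom_def by blast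

lemma LY_iff:
  "u \<in> LY n a b \<longleftrightarrow>
    (\<forall>I. lookup u I \<noteq> 0 \<longrightarrow> I \<subseteq> {1..n} \<and> card I = a) \<and> (\<forall>I. lookup u I \<in> Yhom n b)"
proof
  assume u: "u \<in> LY n a b"
  have "lookup u I \<in> Yhom n b" for I
    using u by (cases "I \<in> keys u") (simp_all add: LY_def in_keys_iff)
  then show "(\<forall>I. lookup u I \<noteq> 0 \<longrightarrow> I \<subseteq> {1..n} \<and> card I = a) \<and> (\<forall>I. lookup u I \<in> Yhom n b)"
    using u by (simp add: LY_def Nn_def in_keys_iff)
next
  assume "(\<forall>I. lookup u I \<noteq> 0 \<longrightarrow> I \<subseteq> {1..n} \<and> card I = a) \<and> (\<forall>I. lookup u I \<in> Yhom n b)"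
  then show "u \<in> LY n a b"
    by (simp add: LY_def Nn_def in_keys_iff Yhom_def)
qed

lemma LY_0: "0 \<in> LY n a b"
  by (simp add: LY_iff)

lemma LY_add:
  assumes "u \<in> LY n a b" "v \<in> LY n a b"
  shows "u + v \<in> LY n a b"
proof -
  have "lookup u I \<noteq> 0 \<or> lookup v I \<noteq> 0" if "lookup (u + v) I \<noteq> 0" for I
    using that by (auto simp: lookup_add)
  then show ?thesis
    using assms unfolding LY_iff by (simp only: lookup_add Yhom_add) blast
qed

lemma LY_sum: "(\<And>x. x \<in> A \<Longrightarrow> f x \<in> LY n a b) \<Longrightarrow> (\<Sum>x\<in>A. f x) \<in> LY n a b"
  by (induction A rule: infinite_finite_induct) (simp_all add: LY_add LY_0)

lemma LY_single:
  assumes "I \<subseteq> {1..n}" "card I = a" "keys e \<subseteq> {1..n}" "mdeg e = b"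
  shows "single I (ymon e) \<in> LY n a b"
proof -
  have "ymon e \<in> Yhom n b" using assms(3,4) by (simp add: Yhom_def ymon_Yn) (simp add: ymon_def)
  then show ?thesis using assms(1,2) unfolding LY_iff by (simp add: lookup_single when_def)
qed

lemma LG_iff: "u \<in> LG n k \<longleftrightarrow> u \<in> LY n k (d1 n k) \<and> (\<forall>I. lookup u I \<in> Gn n k)"
proof -
  have "lookup u I \<in> Gn n k" if "I \<notin> keys u" for I
    using that Gn_0 by (simp add: in_keys_iff)
  then show ?thesis unfolding LG_def by blast
qed

lemma LG_0: "0 \<in> LG n k"
  by (simp add: LG_iff LY_0 Gn_0)

lemma LG_add: "u \<in> LG n k \<Longrightarrow> v \<in> LG n k \<Longrightarrow> u + v \<in> LG n k"
  by (simp add: LG_iff LY_add Gn_add lookup_add)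

lemma ell_LG: "I \<subseteq> {1..n} \<Longrightarrow> u \<in> LG n k \<Longrightarrow> ell n k I u = 0"
  by (simp add: ell_def LG_iff lam_Gn)

abbreviation LY_group :: "nat \<Rightarrow> nat \<Rightarrow> nelt monoid"
  where "LY_group n k \<equiv> additive_group (LY n k (d1 n k))"

lemma comm_group_LY: "comm_group (LY_group n k)"
  by (rule comm_group_additive_group) (simp_all add: LY_0 LY_add nelt_uminus)

lemma subgroup_LG: "subgroup (LG n k) (LY_group n k)"
proof -
  interpret comm_group "LY_group n k" by (rule comm_group_LY)
  show ?thesis
  proof (rule subgroupI)
    show "LG n k \<subseteq> carrier (LY_group n k)" by (auto simp: additive_group_def LG_iff)
    show "LG n k \<noteq> {}" using LG_0 by blast
    fix u v assume u: "u \<in> LG n k" and v: "v \<in> LG n k"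
    show "u \<otimes>\<^bsub>LY_group n k\<^esub> v \<in> LG n k" using LG_add[OF u v] by (simp add: additive_group_def)
    have "inv\<^bsub>LY_group n k\<^esub> u = u"
      by (rule inv_equality) (use u in \<open>simp_all add: additive_group_def LG_iff\<close>)
    then show "inv\<^bsub>LY_group n k\<^esub> u \<in> LG n k" using u by simp
  qed
qed

lemma comm_group_Quot: "comm_group (Quot n k)"
  unfolding Quot_def by (rule comm_group.abelian_FactGroup[OF comm_group_LY subgroup_LG])

lemma normal_LG: "LG n k \<lhd> LY_group n k"
  by (rule comm_group.subgroup_imp_normal[OF comm_group_LY subgroup_LG])

lemma quot_map_add:
  assumes "u \<in> LY n k (d1 n k)" "v \<in> LY n k (d1 n k)"
  shows "quot_map n k u \<otimes>\<^bsub>Quot n k\<^esub> quot_map n k v = quot_map n k (u + v)"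
  using hom_mult[OF normal.r_coset_hom_Mod[OF normal_LG, of n k], of u v] assms
  by (simp add: quot_map_def Quot_def additive_group_def)

lemma quot_map_carrier: "u \<in> LY n k (d1 n k) \<Longrightarrow> quot_map n k u \<in> carrier (Quot n k)"
  by (auto simp: Quot_def carrier_FactGroup quot_map_def additive_group_def)

lemma quot_map_0: "quot_map n k 0 = \<one>\<^bsub>Quot n k\<^esub>"
proof -
  have "quot_map n k 0 = LG n k"
    by (auto simp: quot_map_def r_coset_def additive_group_def)
  then show ?thesis by (simp add: Quot_def)
qed

lemma quot_map_eq_iff:
  "quot_map n k u = quot_map n k v \<longleftrightarrow> u + v \<in> LG n k"
proof -
  have q: "quot_map n k w = (\<lambda>g. g + w) ` LG n k" for w
    by (auto simp: quot_map_def r_coset_def additive_group_def)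
  have cancel: "x + y + y = x" for x y :: nelt by (simp add: add.assoc)
  show ?thesis
  proof
    assume "quot_map n k u = quot_map n k v"
    moreover have "u \<in> quot_map n k u" unfolding q using LG_0 by (intro image_eqI[of _ _ 0]) auto
    ultimately obtain g where "g \<in> LG n k" "u = g + v" unfolding q by blast
    then show "u + v \<in> LG n k" by (simp only: cancel)
  next
    assume uv: "u + v \<in> LG n k"
    have sub: "quot_map n k x \<subseteq> quot_map n k y" if xy: "x + y \<in> LG n k" for x y
    proof
      fix w assume "w \<in> quot_map n k x"
      then obtain g where g: "g \<in> LG n k" "w = g + x" unfolding q by blast
      have "w = (g + (x + y)) + y" unfolding g(2) add.assoc[symmetric] cancel ..
      then show "w \<in> quot_map n k y" unfolding q using LG_add[OF g(1) xy] by (rule image_eqI)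
    qed
    have "v + u \<in> LG n k" using uv by (simp only: add.commute)
    then show "quot_map n k u = quot_map n k v" using sub uv by blast
  qed
qed

lemma quot_map_inv:
  assumes "u \<in> LY n k (d1 n k)"
  shows "inv\<^bsub>Quot n k\<^esub> (quot_map n k u) = quot_map n k u"
proof -
  interpret comm_group "Quot n k" by (rule comm_group_Quot)
  show ?thesis
    by (rule inv_equality) (use assms in \<open>simp_all add: quot_map_add quot_map_0 quot_map_carrier\<close>)
qed

text \<open>Coefficients are 0 or 1 and every class is its own inverse, so the sums over finite
  subsets already form a group.\<close>

lemma generate_quot_map:
  assumes B: "B \<subseteq> LY n k (d1 n k)"
  shows "generate (Quot n k) (quot_map n k ` B) = {quot_map n k (\<Sum>F) | F. F \<subseteq> B \<and> finite F}"
proof -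
  have sumF: "\<Sum>F \<in> LY n k (d1 n k)" if "F \<subseteq> B" for F
    by (rule LY_sum) (use that B in blast)
  have "\<exists>F\<subseteq>B. finite F \<and> x = quot_map n k (\<Sum>F)"
    if "x \<in> generate (Quot n k) (quot_map n k ` B)" for x
    using that
  proof (induction rule: generate.induct)
    case one
    then show ?case using quot_map_0[of n k] by (intro exI[of _ "{}"]) simp
  next
    case (incl h)
    then obtain b where "b \<in> B" "h = quot_map n k b" by blast
    then show ?case by (intro exI[of _ "{b}"]) simp
  next
    case (inv h)
    then obtain b where b: "b \<in> B" "h = quot_map n k b" by blast
    then have "inv\<^bsub>Quot n k\<^esub> h = quot_map n k b" using quot_map_inv[of b n k] B by blast
    then show ?case using b by (intro exI[of _ "{b}"]) simp
  next
    case (eng h1 h2)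
    then obtain F1 F2 where F: "h1 = quot_map n k (\<Sum>F1)" "F1 \<subseteq> B" "finite F1"
      "h2 = quot_map n k (\<Sum>F2)" "F2 \<subseteq> B" "finite F2" by blast
    have "h1 \<otimes>\<^bsub>Quot n k\<^esub> h2 = quot_map n k (\<Sum>(sym_diff F1 F2))"
      unfolding F(1,4) quot_map_add[OF sumF[OF F(2)] sumF[OF F(5)]] sum_sym_diff_nelt[OF F(3,6)] ..
    moreover have "sym_diff F1 F2 \<subseteq> B" "finite (sym_diff F1 F2)" using F by auto
    ultimately show ?case by blast
  qed
  moreover have "quot_map n k (\<Sum>F) \<in> generate (Quot n k) (quot_map n k ` B)"
    if "finite F" "F \<subseteq> B" for F
    using that
  proof (induction F rule: finite_induct)
    case empty
    then show ?case by (simp add: quot_map_0 generate.one)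
  next
    case (insert b F)
    then have b: "b \<in> B" "F \<subseteq> B" by auto
    have "quot_map n k b \<otimes>\<^bsub>Quot n k\<^esub> quot_map n k (\<Sum>F) \<in>
        generate (Quot n k) (quot_map n k ` B)"
      by (rule generate.eng[OF generate.incl[OF imageI[OF b(1)]] insert.IH[OF b(2)]])
    then show ?case
      using insert.hyps quot_map_add[OF subsetD[OF B b(1)] sumF[OF b(2)]] by simp
  qed
  ultimately show ?thesis by blast
qed

section \<open>Coordinates on V\<close>

lemma sigma_z_LY:
  assumes "\<sigma> \<in> Mono_maps n k"
  shows "sigma_z n k \<sigma> \<in> LY n k (d1 n k)"
proof -
  note \<sigma> = Mono_mapsD(2,3)[OF assms]
  obtain m where "bij_betw m (\<sigma> ` {1..k}) {..<k}"
    "sigma_z n k \<sigma> = single (\<sigma> ` {1..k}) (ymon (defexp n k (\<sigma> ` {1..k}) m))"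
    using sigma_z_deficient[OF assms] by (auto simp: deficient_def)
  then show ?thesis
    using LY_single[OF \<sigma> keys_defexp mdeg_defexp[OF \<sigma>(1)]] by simp
qed

lemma ell_sigma_z:
  assumes "\<sigma> \<in> Mono_maps n k"
  shows "ell n k I (sigma_z n k \<sigma>) = (if I = \<sigma> ` {1..k} then 1 else 0)"
proof -
  obtain e where "deficient n k (\<sigma> ` {1..k}) e" "sigma_z n k \<sigma> = single (\<sigma> ` {1..k}) (ymon e)"
    using sigma_z_deficient[OF assms] by blast
  then show ?thesis by (simp add: ell_single)
qed

lemma inj_on_sigma_z: "inj_on (sigma_z n k) (Mono_maps n k)"
proof (rule inj_onI)
  fix \<sigma> \<tau> assume *: "\<sigma> \<in> Mono_maps n k" "\<tau> \<in> Mono_maps n k" "sigma_z n k \<sigma> = sigma_z n k \<tau>"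
  have "\<sigma> ` {1..k} = \<tau> ` {1..k}"
    using ell_sigma_z[OF *(1), of "\<sigma> ` {1..k}"] ell_sigma_z[OF *(2), of "\<sigma> ` {1..k}"] *(3)
    by (auto split: if_splits)
  then show "\<sigma> = \<tau>" by (rule Mono_maps_eqI[OF *(1,2)])
qed

lemma bij_betw_Mono_maps: "bij_betw (\<lambda>\<sigma>. \<sigma> ` {1..k}) (Mono_maps n k) (k_subsets n k)"
proof -
  have "inj_on (\<lambda>\<sigma>. \<sigma> ` {1..k}) (Mono_maps n k)"
    by (rule inj_onI) (rule Mono_maps_eqI)
  moreover have "(\<lambda>\<sigma>. \<sigma> ` {1..k}) ` Mono_maps n k = k_subsets n k"
  proof
    show "(\<lambda>\<sigma>. \<sigma> ` {1..k}) ` Mono_maps n k \<subseteq> k_subsets n k"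
      using Mono_mapsD(2,3) by (simp add: image_subset_iff k_subsets_def)
    show "k_subsets n k \<subseteq> (\<lambda>\<sigma>. \<sigma> ` {1..k}) ` Mono_maps n k"
    proof
      fix I assume "I \<in> k_subsets n k"
      then obtain \<sigma> where "\<sigma> \<in> Mono_maps n k" "\<sigma> ` {1..k} = I"
        using Mono_maps_image[of I n k] unfolding k_subsets_def by blast
      then show "I \<in> (\<lambda>\<sigma>. \<sigma> ` {1..k}) ` Mono_maps n k" by (intro image_eqI[of _ _ \<sigma>]) simp_all
    qed
  qed
  ultimately show ?thesis by (simp add: bij_betw_def)
qed

definition zsum :: "nat \<Rightarrow> nat \<Rightarrow> (nat \<Rightarrow> nat) set \<Rightarrow> nelt"
  where "zsum n k T = (\<Sum>\<sigma>\<in>T. sigma_z n k \<sigma>)"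

text \<open>The coordinate set of the V-component, read off from any representative: it is left
  inverse to \<open>zsum\<close> by \<open>zsupp_zsum\<close> and depends only on the class by
  \<open>zsupp_LG\<close>.\<close>

definition zsupp :: "nat \<Rightarrow> nat \<Rightarrow> nelt \<Rightarrow> (nat \<Rightarrow> nat) set"
  where "zsupp n k u = {\<sigma> \<in> Mono_maps n k. ell n k (\<sigma> ` {1..k}) u = 1}"

lemma zsum_LY: "T \<subseteq> Mono_maps n k \<Longrightarrow> zsum n k T \<in> LY n k (d1 n k)"
  unfolding zsum_def by (intro LY_sum sigma_z_LY) auto

lemma ell_zsum:
  assumes "T \<subseteq> Mono_maps n k" "\<sigma> \<in> Mono_maps n k"
  shows "ell n k (\<sigma> ` {1..k}) (zsum n k T) = (if \<sigma> \<in> T then 1 else 0)"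
proof -
  have "finite T" using assms(1) finite_Mono_maps by (rule finite_subset)
  have "ell n k (\<sigma> ` {1..k}) (sigma_z n k \<tau>) = (if \<tau> = \<sigma> then 1 else 0)" if "\<tau> \<in> T" for \<tau>
    unfolding ell_sigma_z[OF subsetD[OF assms(1) that]]
    using Mono_maps_eqI[OF assms(2) subsetD[OF assms(1) that]] by auto
  then have "ell n k (\<sigma> ` {1..k}) (zsum n k T) = (\<Sum>\<tau>\<in>T. if \<tau> = \<sigma> then 1 else 0)"
    unfolding zsum_def ell_sum by (rule sum.cong[OF refl])
  then show ?thesis using \<open>finite T\<close> by simp
qed

lemma zsupp_zsum: "T \<subseteq> Mono_maps n k \<Longrightarrow> zsupp n k (zsum n k T) = T"
  using ell_zsum[of T n k] by (auto simp: zsupp_def split: if_splits)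

lemma zsupp_cong:
  assumes "\<And>I. I \<in> k_subsets n k \<Longrightarrow> ell n k I u = ell n k I v"
  shows "zsupp n k u = zsupp n k v"
proof -
  have "ell n k (\<sigma> ` {1..k}) u = ell n k (\<sigma> ` {1..k}) v" if "\<sigma> \<in> Mono_maps n k" for \<sigma>
    by (rule assms) (use bij_betwE[OF bij_betw_Mono_maps] that in blast)
  then show ?thesis unfolding zsupp_def by (intro Collect_cong conj_cong) simp_all
qed

lemma zsupp_LG:
  assumes "u + v \<in> LG n k"
  shows "zsupp n k u = zsupp n k v"
proof (rule zsupp_cong)
  fix I assume "I \<in> k_subsets n k"
  then have "ell n k I u + ell n k I v = 0"
    using ell_LG[OF _ assms, of I] by (simp add: ell_add k_subsets_def)
  then show "ell n k I u = ell n k I v" by (cases "ell n k I u"; cases "ell n k I v") auto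
qed

lemma par_zsupp: "par n k u = of_nat (card (zsupp n k u))"
proof -
  have "par n k u = (\<Sum>\<sigma>\<in>Mono_maps n k. ell n k (\<sigma> ` {1..k}) u)"
    unfolding par_def by (rule sum.reindex_bij_betw[OF bij_betw_Mono_maps, symmetric])
  also have "\<dots> = (\<Sum>\<sigma>\<in>Mono_maps n k. if ell n k (\<sigma> ` {1..k}) u = 1 then 1 else 0)"
    by (intro sum.cong) auto
  also have "\<dots> = of_nat (card (zsupp n k u))"
    unfolding zsupp_def by (simp add: finite_Mono_maps sum.If_cases Int_def)
  finally show ?thesis .
qed

lemma monomials_LY: "m \<in> monomials n a b \<Longrightarrow> m \<in> LY n a b"
  by (auto simp: monomials_def simp del: One_nat_def intro!: LY_single)

text \<open>A monomial of \<open>M0\<close> detected by \<open>ell\<close> would be congruent to some \<open>\<sigma>(z\<^sub>k)\<close>.\<close>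

lemma ell_M0:
  assumes M0: "admissible_M0 n k M0" and "m \<in> M0" "I \<in> k_subsets n k"
  shows "ell n k I m = 0"
proof (rule ccontr)
  have mLY: "m \<in> LY n k (d1 n k)" and disj: "m \<notin> M1 n k"
    and inj: "inj_on (quot_map n k) (M0 \<union> M1 n k)"
    using M0 assms(2) monomials_LY by (auto simp: admissible_M0_def)
  obtain J e where m: "m = single J (ymon e)"
    using M0 assms(2) unfolding admissible_M0_def monomials_def by blast
  assume "ell n k I m \<noteq> 0"
  then have J: "J = I" "deficient n k I e" by (auto simp: m ell_single split: if_splits)
  then obtain l where l: "bij_betw l I {..<k}" "e = defexp n k I l" by (auto simp: deficient_def)
  have "I \<subseteq> {1..n}" using assms(3) by (simp add: k_subsets_def)
  from defexp_sort[OF this l(1)] obtain \<sigma> e' where \<sigma>: "\<sigma> \<in> Mono_maps n k"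
    "sigma_z n k \<sigma> = single I (ymon e')" "ymon e + ymon e' \<in> Gn n k" unfolding l(2) by blast
  have "m + sigma_z n k \<sigma> = single I (ymon e + ymon e')" by (simp add: m J \<sigma>(2) single_add)
  then have "lookup (m + sigma_z n k \<sigma>) K \<in> Gn n k" for K
    using \<sigma>(3) by (simp add: lookup_single when_def Gn_0)
  then have "m + sigma_z n k \<sigma> \<in> LG n k"
    unfolding LG_iff using LY_add[OF mLY sigma_z_LY[OF \<sigma>(1)]] by blast
  then have "quot_map n k m = quot_map n k (sigma_z n k \<sigma>)" by (simp only: quot_map_eq_iff)
  moreover have "sigma_z n k \<sigma> \<in> M1 n k" using \<sigma>(1) by (simp add: M1_def)
  ultimately show False using inj_onD[OF inj] assms(2) disj by blast
qed

lemma zsupp_M0_zsum: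
  assumes "admissible_M0 n k M0" "F \<subseteq> M0" "T \<subseteq> Mono_maps n k"
  shows "zsupp n k (\<Sum>F + zsum n k T) = T"
proof -
  have "ell n k I (\<Sum>F) = 0" if "I \<in> k_subsets n k" for I
    unfolding ell_sum using assms(2) by (intro sum.neutral ballI ell_M0[OF assms(1) _ that]) auto
  then have "zsupp n k (\<Sum>F + zsum n k T) = zsupp n k (zsum n k T)"
    by (intro zsupp_cong) (simp add: ell_add)
  then show ?thesis by (simp only: zsupp_zsum[OF assms(3)])
qed

lemma M1_LY: "M1 n k \<subseteq> LY n k (d1 n k)"
  by (auto simp: M1_def sigma_z_LY)

lemma sum_M1:
  assumes "F \<subseteq> M1 n k"
  shows "\<exists>T\<subseteq>Mono_maps n k. \<Sum>F = zsum n k T"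
proof -
  obtain T where T: "T \<subseteq> Mono_maps n k" "F = sigma_z n k ` T"
    using assms unfolding M1_def by (metis subset_imageE)
  then have "\<Sum>F = zsum n k T"
    unfolding zsum_def using sum.reindex[OF inj_on_subset[OF inj_on_sigma_z T(1)], of "\<lambda>x. x"] by simp
  then show ?thesis using T(1) by blast
qed

lemma carrier_Vn: "carrier (Vn n k) = (\<lambda>T. quot_map n k (zsum n k T)) ` Pow (Mono_maps n k)"
proof -
  have "carrier (Vn n k) = {quot_map n k (\<Sum>F) | F. F \<subseteq> M1 n k \<and> finite F}"
    using generate_quot_map[OF M1_LY] by (simp add: Vn_def)
  also have "\<dots> = (\<lambda>T. quot_map n k (zsum n k T)) ` Pow (Mono_maps n k)"
  proof (intro Set.set_eqI iffI)
    fix x assume "x \<in> {quot_map n k (\<Sum>F) | F. F \<subseteq> M1 n k \<and> finite F}"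
    then obtain F where F: "F \<subseteq> M1 n k" "x = quot_map n k (\<Sum>F)" by blast
    obtain T where "T \<subseteq> Mono_maps n k" "\<Sum>F = zsum n k T" using sum_M1[OF F(1)] by blast
    then show "x \<in> (\<lambda>T. quot_map n k (zsum n k T)) ` Pow (Mono_maps n k)"
      using F(2) by (intro image_eqI[of _ _ T]) simp_all
  next
    fix x assume "x \<in> (\<lambda>T. quot_map n k (zsum n k T)) ` Pow (Mono_maps n k)"
    then obtain T where T: "T \<subseteq> Mono_maps n k" "x = quot_map n k (zsum n k T)" by blast
    have "zsum n k T = \<Sum>(sigma_z n k ` T)"
      unfolding zsum_def using sum.reindex[OF inj_on_subset[OF inj_on_sigma_z T(1)], of "\<lambda>x. x"] by simp
    moreover have "sigma_z n k ` T \<subseteq> M1 n k" using T(1) unfolding M1_def by (rule image_mono)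
    moreover have "finite (sigma_z n k ` T)"
      using finite_subset[OF T(1) finite_Mono_maps] by (rule finite_imageI)
    ultimately show "x \<in> {quot_map n k (\<Sum>F) | F. F \<subseteq> M1 n k \<and> finite F}"
      using T(2) by (intro CollectI exI[of _ "sigma_z n k ` T"]) simp
  qed
  finally show ?thesis .
qed

text \<open>The basis property supplies some expansion over \<open>M0\<close> and \<open>M1\<close>.
  As \<open>zsupp\<close> is blind to sums from \<open>M0\<close>, it returns the \<open>M1\<close>
  part of any such expansion; this yields both existence and uniqueness of the element described in
  \<open>p_M1\<close>.\<close>

lemma p_M1_quot_map:
  assumes M0: "admissible_M0 n k M0" and u: "u \<in> LY n k (d1 n k)"
  shows "p_M1 n k M0 (quot_map n k u) = quot_map n k (zsum n k (zsupp n k u))"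
proof -
  have sub: "M0 \<subseteq> LY n k (d1 n k)"
    using M0 monomials_LY by (auto simp: admissible_M0_def)
  have sumF: "\<Sum>F \<in> LY n k (d1 n k)" if "F \<subseteq> M0" for F
    using that sub by (intro LY_sum) auto
  have U0: "U0 n k M0 = {quot_map n k (\<Sum>F) | F. F \<subseteq> M0 \<and> finite F}"
    unfolding U0_def by (rule generate_quot_map[OF sub])
  show ?thesis
    unfolding p_M1_def
  proof (rule the_equality)
    have "quot_map n k u \<in> generate (Quot n k) (quot_map n k ` (M0 \<union> M1 n k))"
      using M0 quot_map_carrier[OF u] by (simp add: admissible_M0_def F2_basis_def)
    then obtain F where F: "quot_map n k u = quot_map n k (\<Sum>F)" "F \<subseteq> M0 \<union> M1 n k" "finite F"
      unfolding generate_quot_map[OF Un_least[OF sub M1_LY]] by blast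
    obtain T where T: "T \<subseteq> Mono_maps n k" "\<Sum>(F - M0) = zsum n k T"
      using sum_M1[of "F - M0" n k] F(2) by blast
    have sum: "\<Sum>F = \<Sum>(F \<inter> M0) + zsum n k T"
      using sum.Int_Diff[OF F(3), of "\<lambda>x. x" M0] T(2) by simp
    have "u + \<Sum>F \<in> LG n k" using F(1) by (simp only: quot_map_eq_iff)
    from zsupp_LG[OF this] have "zsupp n k u = T"
      unfolding sum by (simp only: zsupp_M0_zsum[OF M0 Int_lower2 T(1)])
    then have "quot_map n k u =
        quot_map n k (\<Sum>(F \<inter> M0)) \<otimes>\<^bsub>Quot n k\<^esub> quot_map n k (zsum n k (zsupp n k u))"
      using F(1) sum T(1) by (simp only: quot_map_add[OF sumF[OF Int_lower2] zsum_LY])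
    moreover have "quot_map n k (\<Sum>(F \<inter> M0)) \<in> U0 n k M0" unfolding U0 using F(3) by blast
    moreover have "zsupp n k u \<subseteq> Mono_maps n k" by (auto simp: zsupp_def)
    ultimately show "quot_map n k (zsum n k (zsupp n k u)) \<in> carrier (Vn n k) \<and>
        (\<exists>u'\<in>U0 n k M0. quot_map n k u =
          u' \<otimes>\<^bsub>Quot n k\<^esub> quot_map n k (zsum n k (zsupp n k u)))"
      unfolding carrier_Vn by blast
  next
    fix v assume "v \<in> carrier (Vn n k) \<and> (\<exists>u'\<in>U0 n k M0. quot_map n k u = u' \<otimes>\<^bsub>Quot n k\<^esub> v)"
    then obtain T F where T: "T \<subseteq> Mono_maps n k" "v = quot_map n k (zsum n k T)" and F: "F \<subseteq> M0"
      and eq: "quot_map n k u = quot_map n k (\<Sum>F) \<otimes>\<^bsub>Quot n k\<^esub> v"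
      unfolding carrier_Vn U0 by blast
    have "u + (\<Sum>F + zsum n k T) \<in> LG n k"
      using eq unfolding T(2) quot_map_add[OF sumF[OF F] zsum_LY[OF T(1)]] quot_map_eq_iff .
    from zsupp_LG[OF this] have "zsupp n k u = T" unfolding zsupp_M0_zsum[OF M0 F T(1)] .
    then show "v = quot_map n k (zsum n k (zsupp n k u))" using T(2) by simp
  qed
qed

lemma lookup_pr: "lookup (pr k u) I = (if card I = k then lookup u I else 0)"
  by (simp add: pr_def lookup_sum lookup_single when_def in_keys_iff)

lemma pr_LY:
  assumes "u \<in> Ntop n (dtop n k)"
  shows "pr k u \<in> LY n k (d1 n k)"
proof -
  have u: "u \<in> Nn n" using assms by (simp add: Ntop_def)
  have "lookup u I \<in> Yhom n (d1 n k)" if "card I = k" for I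
  proof -
    have "mdeg e = d1 n k" if e: "e \<in> keys (lookup u I)" for e
    proof -
      have "I \<in> keys u" using e by (auto simp: in_keys_iff)
      then have "card I + 2 * mdeg e = dtop n k" using assms e by (simp add: Ntop_def)
      then show ?thesis using \<open>card I = k\<close> by (simp add: dtop_def)
    qed
    then show ?thesis using Nn_lookup[OF u] by (simp add: Yhom_def)
  qed
  moreover have "I \<subseteq> {1..n}" if "lookup u I \<noteq> 0" for I
    using Nn_keys[OF u that] .
  ultimately show ?thesis unfolding LY_iff lookup_pr by simp
qed

text \<open>\<open>zsupp\<close> looks only at coordinates over k-element sets, and
  \<open>pr k\<close> leaves these unchanged.\<close>

lemma vartheta_zsupp:
  assumes "admissible_M0 n k M0" "u \<in> Ntop n (dtop n k)"
  shows "vartheta n k M0 u = quot_map n k (zsum n k (zsupp n k u))"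
proof -
  have "zsupp n k (pr k u) = zsupp n k u"
    by (rule zsupp_cong) (simp add: ell_def lookup_pr k_subsets_def)
  then show ?thesis
    unfolding vartheta_def p_M1_quot_map[OF assms(1) pr_LY[OF assms(2)]] by simp
qed

section \<open>V as a group, the functional \<open>eps\<close> and its kernel\<close>

lemma comm_group_Vn: "comm_group (Vn n k)"
proof -
  interpret Q: comm_group "Quot n k" by (rule comm_group_Quot)
  have "quot_map n k ` M1 n k \<subseteq> carrier (Quot n k)"
    using M1_LY quot_map_carrier by blast
  then have sub: "subgroup (generate (Quot n k) (quot_map n k ` M1 n k)) (Quot n k)"
    by (rule Q.generate_is_subgroup)
  have "group (Vn n k)"
    unfolding Vn_def by (rule subgroup.subgroup_is_group[OF sub Q.is_group])
  then show ?thesis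
  proof (rule group.group_comm_groupI)
    fix x y assume "x \<in> carrier (Vn n k)" "y \<in> carrier (Vn n k)"
    then have "x \<in> carrier (Quot n k)" "y \<in> carrier (Quot n k)"
      using subgroup.mem_carrier[OF sub] by (simp_all add: Vn_def)
    then show "x \<otimes>\<^bsub>Vn n k\<^esub> y = y \<otimes>\<^bsub>Vn n k\<^esub> x"
      using Q.m_comm by (simp add: Vn_def)
  qed
qed

lemma mult_Vn:
  assumes "S \<subseteq> Mono_maps n k" "T \<subseteq> Mono_maps n k"
  shows "quot_map n k (zsum n k S) \<otimes>\<^bsub>Vn n k\<^esub> quot_map n k (zsum n k T) =
    quot_map n k (zsum n k (sym_diff S T))"
proof -
  have "finite S" "finite T" using assms finite_Mono_maps by (auto intro: finite_subset)
  then show ?thesis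
    using quot_map_add[OF zsum_LY[OF assms(1)] zsum_LY[OF assms(2)]]
    by (simp add: Vn_def zsum_def sum_sym_diff_nelt)
qed

lemma one_Vn: "\<one>\<^bsub>Vn n k\<^esub> = quot_map n k (zsum n k {})"
  by (simp add: Vn_def zsum_def quot_map_0)

text \<open>Translates the coefficient functions in the definition of \<open>eps\<close> into
  subsets of \<open>Mono_maps n k\<close>; the general A serves the induction.\<close>

lemma finprod_Vn:
  fixes c :: "(nat \<Rightarrow> nat) \<Rightarrow> bit"
  assumes "A \<subseteq> Mono_maps n k"
  shows "finprod (Vn n k)
      (\<lambda>\<sigma>. if c \<sigma> = 1 then quot_map n k (sigma_z n k \<sigma>) else \<one>\<^bsub>Vn n k\<^esub>) A =
    quot_map n k (zsum n k {\<sigma> \<in> A. c \<sigma> = 1})"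
proof -
  interpret V: comm_group "Vn n k" by (rule comm_group_Vn)
  let ?f = "\<lambda>\<sigma>. if c \<sigma> = 1 then quot_map n k (sigma_z n k \<sigma>) else \<one>\<^bsub>Vn n k\<^esub>"
  have f: "?f \<sigma> = quot_map n k (zsum n k (if c \<sigma> = 1 then {\<sigma>} else {}))" for \<sigma>
    by (simp add: one_Vn zsum_def)
  have fc: "?f \<in> Mono_maps n k \<rightarrow> carrier (Vn n k)"
    unfolding f carrier_Vn by auto
  have "finite A" using assms finite_Mono_maps by (rule finite_subset)
  then show ?thesis
    using assms
  proof (induction A rule: finite_induct)
    case empty
    have "{\<sigma> \<in> {}. c \<sigma> = 1} = {}" by blast
    then show ?case by (simp only: V.finprod_empty one_Vn)
  next
    case (insert \<sigma> A)
    then have A: "A \<subseteq> Mono_maps n k" "\<sigma> \<in> Mono_maps n k" by auto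
    have "finprod (Vn n k) ?f (insert \<sigma> A) = ?f \<sigma> \<otimes>\<^bsub>Vn n k\<^esub> finprod (Vn n k) ?f A"
    proof (rule V.finprod_insert[OF insert.hyps])
      show "?f \<in> A \<rightarrow> carrier (Vn n k)" "?f \<sigma> \<in> carrier (Vn n k)"
        using funcset_mem[OF fc] A by blast+
    qed
    also have "\<dots> = ?f \<sigma> \<otimes>\<^bsub>Vn n k\<^esub> quot_map n k (zsum n k {\<sigma> \<in> A. c \<sigma> = 1})"
      by (simp only: insert.IH[OF A(1)])
    also have "\<dots> = quot_map n k (zsum n k
        (sym_diff (if c \<sigma> = 1 then {\<sigma>} else {}) {\<sigma> \<in> A. c \<sigma> = 1}))"
      unfolding f using A by (intro mult_Vn) auto
    also have "sym_diff (if c \<sigma> = 1 then {\<sigma>} else {}) {\<sigma> \<in> A. c \<sigma> = 1} =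
        {\<tau> \<in> insert \<sigma> A. c \<tau> = 1}" using insert.hyps by auto
    finally show ?case .
  qed
qed

lemma par_zsum: "T \<subseteq> Mono_maps n k \<Longrightarrow> par n k (zsum n k T) = of_nat (card T)"
  by (simp only: par_zsupp zsupp_zsum)

text \<open>The class determines the support of the coefficient function through
  \<open>zsupp\<close>, so the description in \<open>eps\<close> has a unique solution.\<close>

lemma eps_zsum:
  assumes T: "T \<subseteq> Mono_maps n k"
  shows "eps n k (quot_map n k (zsum n k T)) = par n k (zsum n k T)"
proof -
  have sum: "(\<Sum>\<sigma>\<in>Mono_maps n k. c \<sigma>) = of_nat (card {\<sigma> \<in> Mono_maps n k. c \<sigma> = 1})"
    for c :: "(nat \<Rightarrow> nat) \<Rightarrow> bit"
  proof -
    have "(\<Sum>\<sigma>\<in>Mono_maps n k. c \<sigma>) = (\<Sum>\<sigma>\<in>Mono_maps n k. if c \<sigma> = 1 then 1 else 0)"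
      by (intro sum.cong) auto
    then show ?thesis by (simp add: finite_Mono_maps sum.If_cases Int_def)
  qed
  show ?thesis
    unfolding eps_def finprod_Vn[OF subset_refl] sum par_zsum[OF T]
  proof (rule the_equality)
    have "{\<sigma> \<in> Mono_maps n k. (if \<sigma> \<in> T then 1 else 0 :: bit) = 1} = T" using T by auto
    then show "\<exists>c. quot_map n k (zsum n k T) = quot_map n k (zsum n k {\<sigma> \<in> Mono_maps n k. c \<sigma> = (1::bit)}) \<and>
        (of_nat (card T) :: bit) = of_nat (card {\<sigma> \<in> Mono_maps n k. c \<sigma> = 1})"
      by (intro exI[of _ "\<lambda>\<sigma>. if \<sigma> \<in> T then 1 else 0"]) (simp only:)
  next
    fix b :: bit
    assume "\<exists>c. quot_map n k (zsum n k T) = quot_map n k (zsum n k {\<sigma> \<in> Mono_maps n k. c \<sigma> = (1::bit)}) \<and>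
        b = of_nat (card {\<sigma> \<in> Mono_maps n k. c \<sigma> = 1})"
    then obtain c where c: "zsum n k T + zsum n k {\<sigma> \<in> Mono_maps n k. c \<sigma> = (1::bit)} \<in> LG n k"
      "b = of_nat (card {\<sigma> \<in> Mono_maps n k. c \<sigma> = 1})" unfolding quot_map_eq_iff by blast
    have "T = {\<sigma> \<in> Mono_maps n k. c \<sigma> = 1}"
      using zsupp_LG[OF c(1)] zsupp_zsum[OF T] zsupp_zsum[of "{\<sigma> \<in> Mono_maps n k. c \<sigma> = 1}" n k]
      by blast
    then show "b = of_nat (card T)" using c(2) by simp
  qed
qed

lemma eps_hom: "eps n k \<in> hom (Vn n k) F2"
proof (rule homI)
  fix x y assume "x \<in> carrier (Vn n k)" "y \<in> carrier (Vn n k)"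
  then obtain S T where S: "S \<subseteq> Mono_maps n k" "x = quot_map n k (zsum n k S)"
    and T: "T \<subseteq> Mono_maps n k" "y = quot_map n k (zsum n k T)" unfolding carrier_Vn by blast
  have "finite S" "finite T" using S(1) T(1) finite_Mono_maps by (auto intro: finite_subset)
  then have z: "zsum n k (sym_diff S T) = zsum n k S + zsum n k T"
    unfolding zsum_def by (rule sum_sym_diff_nelt)
  have "sym_diff S T \<subseteq> Mono_maps n k" using S T by blast
  then have "eps n k (x \<otimes>\<^bsub>Vn n k\<^esub> y) = par n k (zsum n k (sym_diff S T))"
    unfolding S(2) T(2) mult_Vn[OF S(1) T(1)] by (rule eps_zsum)
  also have "\<dots> = par n k (zsum n k S) + par n k (zsum n k T)"
    unfolding z by (rule par_add)
  finally show "eps n k (x \<otimes>\<^bsub>Vn n k\<^esub> y) = eps n k x \<otimes>\<^bsub>F2\<^esub> eps n k y"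
    unfolding S(2) T(2) eps_zsum[OF S(1)] eps_zsum[OF T(1)] by (simp only: additive_group_def monoid.select_convs)
qed (simp add: additive_group_def)

lemma eps_surj:
  assumes "k < n"
  shows "eps n k ` carrier (Vn n k) = carrier F2"
proof -
  obtain \<sigma> where \<sigma>: "\<sigma> \<in> Mono_maps n k"
    using Mono_maps_image[of "{1..k}" n k] assms by auto
  have "eps n k (quot_map n k (zsum n k {})) = 0"
    unfolding eps_zsum[OF empty_subsetI] par_zsum[OF empty_subsetI] by simp
  moreover have "eps n k (quot_map n k (zsum n k {\<sigma>})) = 1"
    using \<sigma> by (simp add: eps_zsum par_zsum)
  ultimately have "{0, 1} \<subseteq> eps n k ` carrier (Vn n k)"
    unfolding carrier_Vn using \<sigma> by (auto simp: image_iff)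
  moreover have "(UNIV :: bit set) = {0, 1}" by (auto intro: bit.exhaust)
  ultimately show ?thesis by (auto simp: additive_group_def)
qed

lemma eps_vartheta:
  assumes "admissible_M0 n k M0" "u \<in> Ntop n (dtop n k)"
  shows "eps n k (vartheta n k M0 u) = par n k u"
proof -
  have T: "zsupp n k u \<subseteq> Mono_maps n k" by (auto simp: zsupp_def)
  show ?thesis
    unfolding vartheta_zsupp[OF assms] eps_zsum[OF T] par_zsum[OF T] by (rule par_zsupp[symmetric])
qed

lemma Hit_eq_kernel:
  assumes k: "1 \<le> k" and M0: "admissible_M0 n k M0"
  shows "Hit n k M0 = kernel (Vn n k) F2 (eps n k)"
proof (intro Set.set_eqI iffI)
  fix v assume "v \<in> Hit n k M0"
  then obtain u where u: "u \<in> A_plus n" "u \<in> Ntop n (dtop n k)" "v = vartheta n k M0 u"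
    by (auto simp: Hit_def)
  have "zsupp n k u \<subseteq> Mono_maps n k" by (auto simp: zsupp_def)
  then have "v \<in> carrier (Vn n k)"
    unfolding u(3) vartheta_zsupp[OF M0 u(2)] carrier_Vn by blast
  moreover have "eps n k v = 0"
    unfolding u(3) eps_vartheta[OF M0 u(2)] by (rule par_A_plus[OF k u(1)])
  ultimately show "v \<in> kernel (Vn n k) F2 (eps n k)"
    by (simp add: kernel_def additive_group_def)
next
  fix v assume "v \<in> kernel (Vn n k) F2 (eps n k)"
  then obtain T where T: "T \<subseteq> Mono_maps n k" "v = quot_map n k (zsum n k T)" "eps n k v = 0"
    by (auto simp: kernel_def carrier_Vn additive_group_def)
  \<comment> \<open>T is a set of index maps, whereas \<open>hit_set\<close> speaks of their images;
    the bijection between the two preserves parity.\<close>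
  let ?im = "\<lambda>\<sigma>. \<sigma> ` {1..k}"
  have inj: "inj_on ?im (Mono_maps n k)" and img: "?im ` Mono_maps n k = k_subsets n k"
    using bij_betw_Mono_maps[of k n] by (simp_all add: bij_betw_def)
  have "(of_nat (card T) :: bit) = 0"
    using T(3) unfolding T(2) eps_zsum[OF T(1)] par_zsum[OF T(1)] .
  then have "even (card T)" by (simp add: bit_of_nat split: if_splits)
  then have "even (card (?im ` T))" unfolding card_image[OF inj_on_subset[OF inj T(1)]] .
  moreover have "?im ` T \<subseteq> k_subsets n k" using T(1) img by blast
  ultimately have "hit_set n k (?im ` T)" by (intro hit_set_even[OF k])
  then obtain u where u: "u \<in> A_plus n \<inter> Ntop n (dtop n k)"
    and ell: "\<And>I. I \<in> k_subsets n k \<Longrightarrow> ell n k I u = (if I \<in> ?im ` T then 1 else 0)"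
    unfolding hit_set_def by blast
  have "\<sigma> \<in> zsupp n k u \<longleftrightarrow> \<sigma> \<in> T" if \<sigma>: "\<sigma> \<in> Mono_maps n k" for \<sigma>
  proof -
    have "?im \<sigma> \<in> k_subsets n k" using img \<sigma> by blast
    then have "\<sigma> \<in> zsupp n k u \<longleftrightarrow> ?im \<sigma> \<in> ?im ` T"
      using \<sigma> ell by (simp add: zsupp_def)
    then show ?thesis using inj_on_image_mem_iff[OF inj \<sigma> T(1)] by blast
  qed
  then have "zsupp n k u = T" using T(1) by (auto simp: zsupp_def)
  then have "v = vartheta n k M0 u"
    using vartheta_zsupp[OF M0] u T(2) by simp
  then show "v \<in> Hit n k M0" unfolding Hit_def using u by blast
qed

theorem theorem3p7:
  fixes n k :: nat and M0 :: "nelt set"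
  assumes "n \<ge> 2" and "1 \<le> k" and "k < n"
    and "admissible_M0 n k M0"
  shows "Hit n k M0 = kernel (Vn n k) F2 (eps n k)
    \<and> subgroup (Hit n k M0) (Vn n k)
    \<and> eps n k \<in> hom (Vn n k) F2
    \<and> eps n k ` carrier (Vn n k) = carrier F2
    \<and> Vn n k Mod Hit n k M0 \<cong> F2
    \<and> (\<forall>u \<in> Ntop n (dtop n k). eps n k (vartheta n k M0 u) = 1 \<longrightarrow> u \<notin> A_plus n)
    \<and> (\<forall>S \<subseteq> Mono_maps n k. odd (card S) \<longrightarrow> (\<Sum>\<sigma>\<in>S. sigma_z n k \<sigma>) \<notin> A_plus n)"
proof -
  note hit = Hit_eq_kernel[OF assms(2,4)]
  interpret group_hom "Vn n k" F2 "eps n k"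
    using comm_group_Vn[of n k] comm_group_F2 eps_hom[of n k]
    by (simp add: group_hom_def group_hom_axioms_def comm_group_def)
  have "u \<notin> A_plus n" if "u \<in> Ntop n (dtop n k)" "eps n k (vartheta n k M0 u) = 1" for u
    using that par_A_plus[OF assms(2), of u n] eps_vartheta[OF assms(4) that(1)] by auto
  \<comment> \<open>\<open>par\<close> counts S modulo 2 and vanishes on
    \<open>A_plus n\<close>.\<close>
  moreover have "(\<Sum>\<sigma>\<in>S. sigma_z n k \<sigma>) \<notin> A_plus n"
    if S: "S \<subseteq> Mono_maps n k" "odd (card S)" for S
    using par_A_plus[OF assms(2), of "zsum n k S" n] S par_zsum[OF S(1)]
    by (auto simp: zsum_def bit_of_nat)
  moreover have "Vn n k Mod Hit n k M0 \<cong> F2"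
    unfolding hit by (rule FactGroup_iso[OF eps_surj[OF assms(3)]])
  ultimately show ?thesis
    using hit subgroup_kernel homh eps_surj[OF assms(3)] by simp
qed

end
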